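(* Let $A,B:X\rightrightarrows X^*$ be maximal monotone operators in the Banach space $X$. ($\alpha$) If $D(A)\cap D(B)$ is nonempty, closed and convex, and $N_{D(A)\cap D(B)}=N_{D(A)}+N_{D(B)}$, then $A+B$ is of NI type. ($\beta$) If $D(A)$, $D(B)$ are closed and convex and $0\in{}^{\rm ic}(D(A)-D(B))$, then $A+B$ is maximal monotone. ($\gamma$) If $D(A)\cap D(B)$ is closed, $\overline{D(A)}$ is convex, and $D(A)\cap\operatorname{int}D(B)\neq\emptyset$, then $\overline{D(A)}\cap\overline{D(B)}=D(A)\cap D(B)$ and $A+B$ is maximal monotone. ($\delta$) If $D(A)$ is closed and convex and $D(A)\subset D(B)$, then $A+B$ is of NI type. ($\epsilon$) If $D(A)$ is closed and convex, $D(A)\subset D(B)$, and $0\in{}^{\rm ic}(D(A)-P_XD(h_B))$, then $A+B$ is maximal monotone.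
   Context: All Banach spaces are real; $X$ is a possibly non-reflexive Banach space with dual $X^*$. A multi-valued operator $A:X\rightrightarrows X^*$ is identified with its graph $A\subset Z:=X\times X^*$; its domain is $D(A)=\{x: Ax\neq\emptyset\}$. Write $p(x,x^* )=\langle x,x^*\rangle=x^*(x)$. $A$ is monotone if $p(a_1-a_2)\ge 0$ for all $a_1,a_2\in A$, and maximal monotone if it is monotone and maximal under inclusion among monotone subsets of $X\times X^*$. The sum is $(A+B)(x)=\{a^*+b^*: a^*\in Ax,\ b^*\in Bx\}$. For $z=(x,x^* )$, $w=(y,y^* )$ in $Z$ put $z\cdot w=x^*(y)+y^*(x)$. The Fitzpatrick function of a nonempty $A\subset Z$ is $h_A(z)=\sup_{a\in A}\{z\cdot a-p(a)\}$, $z\in Z$. A nonempty $A$ is of NI type if $h_A(z)\ge p(z)$ for every $z\in Z$. For an extended-real-valued function $h$ on $Z$, $D(h)=\{z: h(z)<+\infty\}$, and $P_X:X\times X^*\to X$, $P_X(x,x^* )=x$. For $C\subset X$, the normal cone operator is $N_C(x)=\{x^*\in X^*:\langle y-x,x^*\rangle\le 0\ \forall y\in C\}$ for $x\in C$ and $N_C(x)=\emptyset$ for $x\notin C$. For a subset $S$ of a Banach space, ${}^iS$ denotes its relative algebraic interior, i.e. the algebraic interior (core) of $S$ relative to its affine hull; ${}^{\rm ic}S={}^iS$ if the affine hull of $S$ is closed, and ${}^{\rm ic}S=\emptyset$ otherwise. Closure, closedness and $\operatorname{int}$ for subsets of $X$ are with respect to the norm. *)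

theory Defs
  imports "HOL-Analysis.Analysis" "HOL-Library.Extended_Real"
begin

text \<open>A multi-valued operator from a Banach space to its dual is its graph. Its domain is
  \<^const>\<open>Domain\<close> and the projection of a subset of the product onto the first factor
  is its image under \<^const>\<open>fst\<close>.\<close>

type_synonym 'a dual = "'a \<Rightarrow>\<^sub>L real"
type_synonym 'a operator = "('a \<times> 'a dual) set"

definition pairing :: "'a::real_normed_vector \<times> 'a dual \<Rightarrow> real" where
  "pairing z = blinfun_apply (snd z) (fst z)"

definition coupling :: "'a::real_normed_vector \<times> 'a dual \<Rightarrow> 'a \<times> 'a dual \<Rightarrow> real" where
  "coupling z w = blinfun_apply (snd z) (fst w) + blinfun_apply (snd w) (fst z)"

definition monotone_operator :: "'a::real_normed_vector operator \<Rightarrow> bool" where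
  "monotone_operator A \<longleftrightarrow> (\<forall>a\<^sub>1\<in>A. \<forall>a\<^sub>2\<in>A. 0 \<le> pairing (a\<^sub>1 - a\<^sub>2))"

definition maximal_monotone :: "'a::real_normed_vector operator \<Rightarrow> bool" where
  "maximal_monotone A \<longleftrightarrow>
     monotone_operator A \<and> (\<forall>B. monotone_operator B \<and> A \<subseteq> B \<longrightarrow> B = A)"

definition operator_sum ::
    "'a::real_normed_vector operator \<Rightarrow> 'a operator \<Rightarrow> 'a operator" where
  "operator_sum A B = {(x, a + b) | x a b. (x, a) \<in> A \<and> (x, b) \<in> B}"

definition fitzpatrick ::
    "'a::real_normed_vector operator \<Rightarrow> 'a \<times> 'a dual \<Rightarrow> ereal" where
  "fitzpatrick A z = (SUP a\<in>A. ereal (coupling z a - pairing a))"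

definition NI_type :: "'a::real_normed_vector operator \<Rightarrow> bool" where
  "NI_type A \<longleftrightarrow> A \<noteq> {} \<and> (\<forall>z. ereal (pairing z) \<le> fitzpatrick A z)"

definition effective_domain :: "('b \<Rightarrow> ereal) \<Rightarrow> 'b set" where
  "effective_domain h = {z. h z < \<infinity>}"

definition normal_cone :: "'a::real_normed_vector set \<Rightarrow> 'a operator" where
  "normal_cone C = {(x, x'). x \<in> C \<and> (\<forall>y\<in>C. blinfun_apply x' (y - x) \<le> 0)}"

text \<open>On sets, the library's minus is the set difference; this is the Minkowski difference.\<close>

definition difference_set :: "'a::real_vector set \<Rightarrow> 'a set \<Rightarrow> 'a set" where
  "difference_set S T = {s - t | s t. s \<in> S \<and> t \<in> T}"

text \<open>The directions \<open>y - x\<close> with \<open>x \<in> S\<close> and \<open>y\<close> in the affine hull of \<open>S\<close> are exactly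
  the vectors of the linear subspace parallel to that affine hull.\<close>

definition rel_algebraic_interior :: "'a::real_vector set \<Rightarrow> 'a set" where
  "rel_algebraic_interior S =
     {x \<in> S. \<forall>y \<in> affine hull S. \<exists>\<delta>>0. \<forall>t\<in>{0..\<delta>}. x + t *\<^sub>R (y - x) \<in> S}"

definition ic :: "'a::real_normed_vector set \<Rightarrow> 'a set" where
  "ic S = (if closed (affine hull S) then rel_algebraic_interior S else {})"

end

theory Submission imports Defs begin

text \<open>A maximal monotone operator absorbs the normal cone of its domain. So if \<open>z = (x, x')\<close> violates
  the NI inequality for \<open>A + B\<close> and \<open>x\<close> lies outside \<open>C = D(A) \<inter> D(B)\<close>, adding arbitrarily large
  multiples of a normal vector \<open>n\<close> to \<open>C\<close> at a point \<open>y\<close> with \<open>n (x - y) > 0\<close> (Ekeland's principle)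
  gives a contradiction; if \<open>x\<close> lies in \<open>C\<close>, a point of \<open>A + B\<close> over \<open>x\<close> does.

  For maximality, let \<open>z\<close> be monotonically related to \<open>A + B\<close>. The NI inequality is tight at \<open>z\<close>, so
  it can be differentiated there, which yields \<open>h\<^sub>A (y, y') + h\<^sub>B (y, v') \<ge> z \<cdot> (y, y' + v') - p(z)\<close>.
  Fenchel duality under the algebraic interior condition separates the base points of the two
  summands by some \<open>u\<close>, and maximality of \<open>A\<close> and \<open>B\<close> then puts \<open>(x, x' + u)\<close> in \<open>A\<close>
  and \<open>(x, - u)\<close> in \<open>B\<close>.\<close>

subsection \<open>Hahn-Banach\<close>

definition sublinear :: "('a::real_vector \<Rightarrow> real) \<Rightarrow> bool" where
  "sublinear q \<longleftrightarrow> (\<forall>x y. q (x + y) \<le> q x + q y) \<and> (\<forall>t\<ge>0. \<forall>x. q (t *\<^sub>R x) = t * q x)"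

lemma sublinear_ge_neg:
  assumes "sublinear q"
  shows "- q (- x) \<le> q x"
proof -
  have "q 0 = 0"
    using assms unfolding sublinear_def by (metis mult_zero_left order_refl scale_zero_left)
  moreover have "q (x + - x) \<le> q x + q (- x)"
    using assms unfolding sublinear_def by blast
  ultimately show ?thesis by simp
qed

text \<open>Subhomogeneity for every positive factor already forces equality: applied to
  \<open>inverse t\<close> it yields the opposite inequality.\<close>

lemma sublinearI:
  assumes add: "\<And>x y. q (x + y) \<le> q x + q y"
    and scale: "\<And>t x. 0 < t \<Longrightarrow> q (t *\<^sub>R x) \<le> t * q x"
    and zero: "q 0 = 0"
  shows "sublinear q"
  unfolding sublinear_def
proof (intro conjI allI impI)
  fix t :: real and x
  assume "0 \<le> t"
  show "q (t *\<^sub>R x) = t * q x"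
  proof (cases "t = 0")
    case False
    with \<open>0 \<le> t\<close> have t: "0 < t" by simp
    have "q (inverse t *\<^sub>R (t *\<^sub>R x)) \<le> inverse t * q (t *\<^sub>R x)"
      using t by (intro scale) simp
    then have "t * q x \<le> q (t *\<^sub>R x)"
      using t by (simp add: field_simps)
    with scale[OF t, of x] show ?thesis by simp
  qed (simp add: zero)
qed (rule add)

text \<open>A pointwise minimal sublinear functional below \<open>Q\<close> is linear.\<close>

lemma hahn_banach_sublinear:
  fixes Q :: "'a::real_vector \<Rightarrow> real"
  assumes Q: "sublinear Q"
  shows "\<exists>f. linear f \<and> (\<forall>x. f x \<le> Q x)"
proof -
  define S where "S = {q. sublinear q \<and> q \<le> Q}"
  \<comment> \<open>The order is reversed, so the maximal element supplied by Zorn's lemma is a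
    pointwise minimal sublinear functional.\<close>
  define P :: "('a \<Rightarrow> real) \<Rightarrow> ('a \<Rightarrow> real) \<Rightarrow> bool" where "P = (\<lambda>p q. q \<le> p)"
  have "\<exists>m\<in>S. \<forall>a\<in>S. P m a \<longrightarrow> a = m"
  proof (rule predicate_Zorn)
    show "partial_order_on S (relation_of P S)"
      unfolding P_def by (intro partial_order_on_relation_ofI) auto
  next
    fix C assume "C \<in> Chains (relation_of P S)"
    then have CS: "q \<in> S" and chain: "p \<le> q \<or> q \<le> p" if "p \<in> C" "q \<in> C" for p q
      using that unfolding Chains_def relation_of_def P_def by fast+
    show "\<exists>u\<in>S. \<forall>a\<in>C. P a u"
    proof (cases "C = {}")
      case True
      then show ?thesis using Q by (auto simp: S_def)
    next
      case False
      have sub: "sublinear q" "q x \<le> Q x" if "q \<in> C" for q x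
        using CS[OF that that] by (auto simp: S_def le_fun_def)
      have lower: "- Q (- x) \<le> q x" if "q \<in> C" for q x
        using sublinear_ge_neg[OF sub(1)[OF that], of x] sub(2)[OF that, of "- x"] by linarith
      define u where "u x = (INF q\<in>C. q x)" for x
      have bdd: "bdd_below ((\<lambda>q. q x) ` C)" for x
        using lower by (auto intro!: bdd_belowI2)
      have u_le: "u x \<le> q x" if "q \<in> C" for q x
        unfolding u_def using bdd that by (rule cINF_lower)
      have u_ge: "b \<le> u x" if "\<And>q. q \<in> C \<Longrightarrow> b \<le> q x" for b x
        unfolding u_def using False that by (rule cINF_greatest)
      have "sublinear u"
      proof (rule sublinearI)
        fix x y
        have *: "u (x + y) \<le> p x + q y" if pq: "p \<in> C" "q \<in> C" for p q
        proof -
          \<comment> \<open>Subadditivity passes to the infimum because two members of a chain have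
            a common lower bound in the chain.\<close>
          obtain r where r: "r \<in> C" "r \<le> p" "r \<le> q" using chain[OF pq] pq by blast
          have "u (x + y) \<le> r (x + y)" by (rule u_le[OF r(1)])
          also have "\<dots> \<le> r x + r y" using sub(1)[OF r(1)] by (simp add: sublinear_def)
          also have "\<dots> \<le> p x + q y" using r by (auto simp: le_fun_def intro: add_mono)
          finally show ?thesis .
        qed
        have "u (x + y) - q y \<le> u x" if "q \<in> C" for q
          using *[OF _ that] by (intro u_ge) (simp add: algebra_simps)
        then have "u (x + y) - u x \<le> u y"
          by (intro u_ge) (simp add: algebra_simps)
        then show "u (x + y) \<le> u x + u y" by simp
      next
        fix t :: real and x assume t: "0 < t"
        have "u (t *\<^sub>R x) / t \<le> u x"
        proof (rule u_ge)
          fix q assume q: "q \<in> C"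
          have "u (t *\<^sub>R x) \<le> t * q x"
            using u_le[OF q, of "t *\<^sub>R x"] sub(1)[OF q] t by (simp add: sublinear_def)
          then show "u (t *\<^sub>R x) / t \<le> q x" using t by (simp add: field_simps)
        qed
        then show "u (t *\<^sub>R x) \<le> t * u x" using t by (simp add: field_simps)
      next
        have "q 0 = 0" if "q \<in> C" for q
          using sub(1)[OF that] unfolding sublinear_def
          by (metis mult_zero_left order_refl scale_zero_left)
        then have "(\<lambda>q. q 0) ` C = {0}" using False by force
        then show "u 0 = 0" by (simp add: u_def)
      qed
      moreover have "u \<le> Q"
        using False u_le sub(2) by (metis equals0I le_funI order_trans)
      ultimately show ?thesis
        using u_le by (auto simp: S_def P_def le_fun_def)
    qed
  qed
  then obtain m where m: "sublinear m" "m \<le> Q"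
    and min: "\<And>q. sublinear q \<Longrightarrow> q \<le> m \<Longrightarrow> q = m"
    unfolding S_def P_def by (auto intro: order_trans)
  have madd: "m (x + y) \<le> m x + m y" and mscale: "0 \<le> t \<Longrightarrow> m (t *\<^sub>R x) = t * m x" for x y t
    using m(1) by (auto simp: sublinear_def)
  have m0: "m 0 = 0" using mscale[of 0 0] by simp
  have odd: "m (- y) = - m y" for y
  proof -
    \<comment> \<open>This functional is again sublinear and lies below \<open>m\<close> (take
      \<open>t = 0\<close>), so minimality gives \<open>q = m\<close>. Taking \<open>t = 1\<close>
      at \<open>- y\<close> then shows m(-y) <= -m(y).\<close>
    define q where "q x = (INF t\<in>{0..}. m (x + t *\<^sub>R y) - t * m y)" for x
    have lower: "- m (- x) \<le> m (x + t *\<^sub>R y) - t * m y" if "0 \<le> t" for x t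
      using madd[of "x + t *\<^sub>R y" "- x"] mscale[OF that, of y] by simp
    have bdd: "bdd_below ((\<lambda>t. m (x + t *\<^sub>R y) - t * m y) ` {0..})" for x
      using lower by (auto intro!: bdd_belowI2)
    have q_le: "q x \<le> m (x + t *\<^sub>R y) - t * m y" if "0 \<le> t" for x t
      unfolding q_def using bdd that by (intro cINF_lower) auto
    have q_ge: "b \<le> q x" if "\<And>t. 0 \<le> t \<Longrightarrow> b \<le> m (x + t *\<^sub>R y) - t * m y" for b x
      unfolding q_def using that by (intro cINF_greatest) auto
    have "sublinear q"
    proof (rule sublinearI)
      fix a b
      have *: "q (a + b) \<le> (m (a + s *\<^sub>R y) - s * m y) + (m (b + t *\<^sub>R y) - t * m y)"
        if "0 \<le> s" "0 \<le> t" for s t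
        using q_le[of "s + t" "a + b"] madd[of "a + s *\<^sub>R y" "b + t *\<^sub>R y"] that
        by (simp add: algebra_simps)
      have "q (a + b) - (m (b + t *\<^sub>R y) - t * m y) \<le> q a" if "0 \<le> t" for t
        using *[OF _ that] by (intro q_ge) (simp add: algebra_simps)
      then have "q (a + b) - q a \<le> q b"
        by (intro q_ge) (simp add: algebra_simps)
      then show "q (a + b) \<le> q a + q b" by simp
    next
      fix r :: real and x assume r: "0 < r"
      have "q (r *\<^sub>R x) / r \<le> q x"
      proof (rule q_ge)
        fix t :: real assume t: "0 \<le> t"
        have "q (r *\<^sub>R x) \<le> m (r *\<^sub>R x + (r * t) *\<^sub>R y) - (r * t) * m y"
          using r t by (intro q_le) simp
        also have "r *\<^sub>R x + (r * t) *\<^sub>R y = r *\<^sub>R (x + t *\<^sub>R y)" by (simp add: algebra_simps)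
        also have "m (r *\<^sub>R (x + t *\<^sub>R y)) = r * m (x + t *\<^sub>R y)" using r by (intro mscale) simp
        finally show "q (r *\<^sub>R x) / r \<le> m (x + t *\<^sub>R y) - t * m y"
          using r by (simp add: field_simps)
      qed
      then show "q (r *\<^sub>R x) \<le> r * q x" using r by (simp add: field_simps)
    next
      have "q 0 \<le> 0" using q_le[of 0 0] m0 by simp
      moreover have "0 \<le> q 0" using mscale by (intro q_ge) simp
      ultimately show "q 0 = 0" by simp
    qed
    moreover have "q \<le> m" using q_le[of 0] by (auto simp: le_fun_def)
    ultimately have "q = m" by (rule min)
    with q_le[of 1 "- y"] m0 have "m (- y) \<le> - m y" by simp
    moreover have "- m y \<le> m (- y)" using madd[of y "- y"] m0 by simp
    ultimately show ?thesis by simp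
  qed
  have "linear m"
  proof (rule linearI)
    fix x y
    show "m (x + y) = m x + m y"
      using madd[of x y] madd[of "- x" "- y"] odd[of "x + y"] odd[of x] odd[of y] by simp
  next
    fix t :: real and x
    show "m (t *\<^sub>R x) = t *\<^sub>R m x"
      using mscale[of t x] mscale[of "- t" x] odd[of "t *\<^sub>R x"] by (cases "0 \<le> t") auto
  qed
  then show ?thesis using m(2) by (auto simp: le_fun_def)
qed

text \<open>\<open>Q\<close> is the infimal convolution of \<open>L * norm\<close> with the
  positively homogeneous hull of \<open>C\<close>; the lower bound on \<open>C\<close> keeps it
  finite. A linear functional below \<open>Q\<close> is bounded, since scale \<open>t = 0\<close>
  gives Q <= L * norm, and it satisfies the required inequality, by scale \<open>t = 1\<close> at
  \<open>x = d\<close>.\<close>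

lemma hahn_banach_convex_set:
  fixes C :: "('a::real_normed_vector \<times> real) set"
  assumes "convex C" and "0 \<le> L" and lower: "\<And>d r. (d, r) \<in> C \<Longrightarrow> - L * norm d \<le> r"
  shows "\<exists>u::'a dual. \<forall>d r. (d, r) \<in> C \<longrightarrow> blinfun_apply u d \<le> r"
proof (cases "C = {}")
  case False
  define I where "I = {0::real..} \<times> C"
  define g where "g x = (\<lambda>(t, d, r). t * r + L * norm (x - t *\<^sub>R d))" for x :: 'a
  define Q where "Q x = (INF i\<in>I. g x i)" for x
  have ne: "I \<noteq> {}" using False by (auto simp: I_def)
  have g_lower: "- L * norm x \<le> g x i" if "i \<in> I" for x i
  proof -
    obtain t d r where i: "i = (t, d, r)" by (cases i)
    with that have t: "0 \<le> t" "(d, r) \<in> C" by (auto simp: I_def)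
    have "norm (t *\<^sub>R d) \<le> norm x + norm (x - t *\<^sub>R d)"
      using norm_triangle_ineq2[of "t *\<^sub>R d" x] by (simp add: norm_minus_commute)
    then have "L * (t * norm d) \<le> L * (norm x + norm (x - t *\<^sub>R d))"
      using \<open>0 \<le> L\<close> t by (intro mult_left_mono) auto
    moreover have "t * (- L * norm d) \<le> t * r"
      using lower t by (intro mult_left_mono) auto
    ultimately show ?thesis by (simp add: g_def i algebra_simps)
  qed
  have bdd: "bdd_below (g x ` I)" for x
    using g_lower by (auto intro!: bdd_belowI2)
  have Q_le: "Q x \<le> t * r + L * norm (x - t *\<^sub>R d)" if "0 \<le> t" "(d, r) \<in> C" for x t d r
    using cINF_lower[OF bdd, of "(t, d, r)" x] that by (simp add: Q_def g_def I_def)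
  have Q_ge: "b \<le> Q x"
    if "\<And>t d r. 0 \<le> t \<Longrightarrow> (d, r) \<in> C \<Longrightarrow> b \<le> t * r + L * norm (x - t *\<^sub>R d)" for b x
    unfolding Q_def using ne that by (intro cINF_greatest) (auto simp: g_def I_def)
  have Q_norm: "Q x \<le> L * norm x" for x
    using False Q_le[of 0 _ _ x] by force
  have "sublinear Q"
  proof (rule sublinearI)
    fix x y
    have *: "Q (x + y) \<le> (s * p + L * norm (x - s *\<^sub>R c)) + (t * r + L * norm (y - t *\<^sub>R d))"
      if "0 \<le> s" "(c, p) \<in> C" "0 \<le> t" "(d, r) \<in> C" for s c p t d r
    proof (cases "s + t = 0")
      case True
      then have "s = 0" "t = 0" using that by auto
      have "L * norm (x + y) \<le> L * (norm x + norm y)"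
        using \<open>0 \<le> L\<close> norm_triangle_ineq by (intro mult_left_mono) auto
      then show ?thesis
        using Q_norm[of "x + y"] \<open>s = 0\<close> \<open>t = 0\<close> by (simp add: algebra_simps)
    next
      case False
      then have st: "0 < s + t" using that by simp
      \<comment> \<open>By convexity, s times one point of \<open>C\<close> plus t times another is
        s + t times a single point of \<open>C\<close>.\<close>
      define e where "e = (s / (s + t)) *\<^sub>R (c, p) + (t / (s + t)) *\<^sub>R (d, r)"
      have "e \<in> C"
        unfolding e_def using st that by (intro convexD[OF \<open>convex C\<close>]) (auto simp: add_divide_distrib[symmetric])
      then have "Q (x + y) \<le> (s + t) * snd e + L * norm (x + y - (s + t) *\<^sub>R fst e)"
        using st by (intro Q_le) auto
      moreover have "snd e = (s * p + t * r) / (s + t)"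
        by (simp add: e_def add_divide_distrib)
      then have "(s + t) * snd e = s * p + t * r"
        using st by simp
      moreover have "(s + t) *\<^sub>R fst e = s *\<^sub>R c + t *\<^sub>R d"
        using st by (simp add: e_def scaleR_add_right)
      moreover have "norm (x + y - (s *\<^sub>R c + t *\<^sub>R d)) \<le> norm (x - s *\<^sub>R c) + norm (y - t *\<^sub>R d)"
        by (rule norm_diff_triangle_ineq)
      then have "L * norm (x + y - (s *\<^sub>R c + t *\<^sub>R d)) \<le> L * (norm (x - s *\<^sub>R c) + norm (y - t *\<^sub>R d))"
        using \<open>0 \<le> L\<close> by (rule mult_left_mono)
      ultimately show ?thesis by (simp add: algebra_simps)
    qed
    have "Q (x + y) - (t * r + L * norm (y - t *\<^sub>R d)) \<le> Q x" if "0 \<le> t" "(d, r) \<in> C" for t d r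
      using *[OF _ _ that] by (intro Q_ge) (simp add: algebra_simps)
    then have "Q (x + y) - Q x \<le> Q y"
      by (intro Q_ge) (simp add: algebra_simps)
    then show "Q (x + y) \<le> Q x + Q y" by simp
  next
    fix k :: real and x assume k: "0 < k"
    have "Q (k *\<^sub>R x) / k \<le> Q x"
    proof (rule Q_ge)
      fix t r :: real and d assume t: "0 \<le> t" "(d, r) \<in> C"
      have "Q (k *\<^sub>R x) \<le> (k * t) * r + L * norm (k *\<^sub>R x - (k * t) *\<^sub>R d)"
        using k t by (intro Q_le) auto
      also have "k *\<^sub>R x - (k * t) *\<^sub>R d = k *\<^sub>R (x - t *\<^sub>R d)"
        by (simp add: algebra_simps)
      also have "norm \<dots> = k * norm (x - t *\<^sub>R d)" using k by simp
      finally show "Q (k *\<^sub>R x) / k \<le> t * r + L * norm (x - t *\<^sub>R d)"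
        using k by (simp add: field_simps)
    qed
    then show "Q (k *\<^sub>R x) \<le> k * Q x" using k by (simp add: field_simps)
  next
    have "0 \<le> Q 0"
      using g_lower[of _ 0] unfolding Q_def by (intro cINF_greatest[OF ne]) auto
    then show "Q 0 = 0" using Q_norm[of 0] by simp
  qed
  then obtain f where f: "linear f" "\<And>x. f x \<le> Q x"
    using hahn_banach_sublinear by blast
  have "\<bar>f x\<bar> \<le> norm x * L" for x
    using f(2)[of x] f(2)[of "- x"] Q_norm[of x] Q_norm[of "- x"] linear_neg[OF f(1), of x]
    by (simp add: mult.commute)
  then have "bounded_linear f"
    using f(1) by (intro bounded_linear.intro bounded_linear_axioms.intro) auto
  moreover have "f d \<le> r" if "(d, r) \<in> C" for d r
    using f(2)[of d] Q_le[of 1 d r d] that by simp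
  ultimately show ?thesis
    by (intro exI[of _ "Blinfun f"]) (auto simp: bounded_linear_Blinfun_apply)
qed auto

subsection \<open>Support points\<close>

text \<open>Ekeland's variational principle for the distance to \<open>x\<close>, which replaces a
  nearest point that may fail to exist. \<open>S a\<close> collects the points that improve on
  \<open>a\<close> at rate at least 1/2. Moving repeatedly to an almost best point of the current
  set gives nested closed sets whose diameters tend to 0, and their common point admits no further
  improvement.\<close>

lemma ekeland_distance:
  fixes C :: "'a::banach set"
  assumes "closed C" "C \<noteq> {}"
  shows "\<exists>a\<in>C. \<forall>y\<in>C. norm (a - x) \<le> norm (y - x) + norm (y - a) / 2"
proof -
  define S where "S a = {y \<in> C. norm (y - x) + norm (y - a) / 2 \<le> norm (a - x)}" for a
  define i where "i a = (INF y\<in>S a. norm (y - x))" for a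
  have S_self: "a \<in> S a" if "a \<in> C" for a using that by (simp add: S_def)
  have S_trans: "S b \<subseteq> S a" if "b \<in> S a" for a b
  proof
    fix y assume "y \<in> S b"
    moreover have "norm (y - a) \<le> norm (y - b) + norm (b - a)"
      using norm_triangle_ineq[of "y - b" "b - a"] by simp
    ultimately show "y \<in> S a" using that by (simp add: S_def)
  qed
  have i_le: "i a \<le> norm (y - x)" if "y \<in> S a" for a y
    unfolding i_def by (rule cINF_lower[OF bdd_belowI2[of _ 0] that]) simp
  have step0: "\<exists>b. b \<in> S a \<and> norm (b - x) < i a + e" if "a \<in> C" "0 < e" for a e
  proof (rule ccontr)
    assume "\<not> ?thesis"
    then have "i a + e \<le> norm (b - x)" if "b \<in> S a" for b using that by force
    then have "i a + e \<le> i a"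
      unfolding i_def using S_self[OF \<open>a \<in> C\<close>] by (intro cINF_greatest) auto
    with \<open>0 < e\<close> show False by simp
  qed
  have step: "\<exists>b. b \<in> C \<and> b \<in> S a \<and> norm (b - x) < i a + (1/2) ^ n" if "a \<in> C" for a n
  proof -
    obtain b where "b \<in> S a" "norm (b - x) < i a + (1/2) ^ n" using step0[of a "(1/2) ^ n"] \<open>a \<in> C\<close> by auto
    then show ?thesis by (auto simp: S_def)
  qed
  obtain a0 where "a0 \<in> C" using assms by blast
  have "\<exists>f. \<forall>n. f n \<in> C \<and> f (Suc n) \<in> S (f n) \<and> norm (f (Suc n) - x) < i (f n) + (1/2) ^ n"
    using \<open>a0 \<in> C\<close> step by (intro dependent_nat_choice) auto
  then obtain f where f: "\<And>n. f n \<in> C" "\<And>n. f (Suc n) \<in> S (f n)"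
    "\<And>n. norm (f (Suc n) - x) < i (f n) + (1/2) ^ n" by blast
  have nested: "S (f n) \<subseteq> S (f m)" if "m \<le> n" for m n
    using that S_trans[OF f(2)] by (rule lift_Suc_antimono_le[of "\<lambda>n. S (f n)", rotated])
  \<comment> \<open>A point of the smaller set still has distance at least \<open>i (f n)\<close> to
    \<open>x\<close>, while \<open>f (Suc n)\<close> exceeds that infimum by less than (1/2)^n. The
    near-optimality chosen at stage n thus controls the set at stage n + 1.\<close>
  have small: "norm (y - f (Suc n)) \<le> 2 * (1/2) ^ n" if "y \<in> S (f (Suc n))" for y n
  proof -
    have "i (f n) \<le> norm (y - x)" using that S_trans[OF f(2)] by (intro i_le) auto
    with f(3)[of n] that show ?thesis by (simp add: S_def)
  qed
  have "Cauchy f"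
  proof (rule metric_CauchyI)
    fix e :: real assume "0 < e"
    then obtain n where n: "(1/2) ^ n < e / 4"
      using real_arch_pow_inv[of "e / 4" "1/2"] by auto
    have near: "norm (f m - f (Suc n)) < e / 2" if "m \<ge> Suc n" for m
      using small[of "f m" n] nested[OF that] S_self[OF f(1)] n by force
    show "\<exists>M. \<forall>m\<ge>M. \<forall>k\<ge>M. dist (f m) (f k) < e"
    proof (intro exI[of _ "Suc n"] allI impI)
      fix m k assume "m \<ge> Suc n" "k \<ge> Suc n"
      then show "dist (f m) (f k) < e"
        using near dist_triangle_half_l[of "f m" "f (Suc n)" e "f k"] by (simp add: dist_norm)
    qed
  qed
  then obtain a where a: "f \<longlonglongrightarrow> a" using Cauchy_convergent convergent_def by blast
  have "closed (S b)" for b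
    unfolding S_def by (intro closed_Collect_conj closed_Collect_le continuous_intros) (simp_all add: assms)
  have aS: "a \<in> S (f n)" for n
  proof (rule closed_sequentially[OF \<open>closed (S (f n))\<close>])
    show "f (k + n) \<in> S (f n)" for k using nested[of n "k + n"] S_self[OF f(1)] by auto
    show "(\<lambda>k. f (k + n)) \<longlonglongrightarrow> a" using a by (rule LIMSEQ_ignore_initial_segment)
  qed
  \<comment> \<open>Such a \<open>y\<close> lies in all the nested sets, so the sequence converges
    to \<open>y\<close> as well as to \<open>a\<close>.\<close>
  have "y = a" if "y \<in> S a" for y
  proof (rule LIMSEQ_unique[of f])
    have "norm (f (Suc n) - y) \<le> 2 * (1/2) ^ n" for n
      using small[of y n] that S_trans[OF aS] by (auto simp: norm_minus_commute)
    moreover have "(\<lambda>n. 2 * (1/2) ^ n :: real) \<longlonglongrightarrow> 2 * 0"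
      by (intro tendsto_intros LIMSEQ_power_zero) simp
    ultimately have "(\<lambda>n. f (Suc n) - y) \<longlonglongrightarrow> 0"
      by (intro Lim_null_comparison[of "\<lambda>n. f (Suc n) - y" "\<lambda>n. 2 * (1/2) ^ n"]) auto
    then show "f \<longlonglongrightarrow> y" using LIM_zero_cancel filterlim_sequentially_Suc by blast
  qed (rule a)
  moreover have "a \<in> C" using aS by (simp add: S_def)
  ultimately have "norm (a - x) \<le> norm (y - x) + norm (y - a) / 2" if "y \<in> C" for y
    using that by (cases "y \<in> S a") (force, simp add: S_def)
  with \<open>a \<in> C\<close> show ?thesis by blast
qed

text \<open>At an Ekeland point \<open>a\<close>, the convex function \<open>\<phi>\<close> has its
  minimum over \<open>C\<close>, with value 0. Separating it from \<open>C\<close> yields a normal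
  vector at \<open>a\<close>. Comparison with the value of \<open>\<phi>\<close> at
  \<open>x\<close>, which is minus half the distance from \<open>a\<close> to \<open>x\<close>,
  gives the strict sign.\<close>

lemma normal_cone_separates:
  fixes C :: "'a::banach set"
  assumes "closed C" "convex C" "C \<noteq> {}" "x \<notin> C"
  shows "\<exists>(a, n)\<in>normal_cone C. 0 < blinfun_apply n (x - a)"
proof -
  obtain a where a: "a \<in> C" "\<And>y. y \<in> C \<Longrightarrow> norm (a - x) \<le> norm (y - x) + norm (y - a) / 2"
    using ekeland_distance[OF assms(1,3)] by blast
  define \<phi> where "\<phi> z = norm (z - x) + norm (z - a) / 2 - norm (a - x)" for z
  have "convex_on UNIV (\<lambda>z. norm (z - b))" for b :: 'a
  proof (rule convex_onI)
    fix t :: real and y z :: 'a assume t: "0 < t" "t < 1"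
    have "(1 - t) *\<^sub>R y + t *\<^sub>R z - b = (1 - t) *\<^sub>R (y - b) + t *\<^sub>R (z - b)"
      by (simp add: algebra_simps)
    then show "norm ((1 - t) *\<^sub>R y + t *\<^sub>R z - b) \<le> (1 - t) * norm (y - b) + t * norm (z - b)"
      using t norm_triangle_ineq[of "(1 - t) *\<^sub>R (y - b)" "t *\<^sub>R (z - b)"] by simp
  qed simp
  moreover have "convex_on UNIV (\<lambda>z::'a. c)" for c :: real
    by (rule convex_onI) (simp_all add: algebra_simps)
  ultimately have "convex_on UNIV (\<lambda>z. norm (z - x) + (1/2) * norm (z - a) + (- norm (a - x)))"
    by (intro convex_on_add convex_on_cmul) simp_all
  then have \<phi>: "convex_on UNIV \<phi>" by (simp add: \<phi>_def[abs_def])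
  \<comment> \<open>A functional \<open>u\<close> with u(d) <= r on all of \<open>K\<close>
    satisfies u(y - z) <= \<open>\<phi> z\<close> for every y in \<open>C\<close> and every
    z.\<close>
  define K where "K = {(y - z, r) | y z r. y \<in> C \<and> \<phi> z \<le> r}"
  have "convex K"
  proof (rule convexI)
    fix p q and s t :: real
    assume "p \<in> K" "q \<in> K" and st: "0 \<le> s" "0 \<le> t" "s + t = 1"
    then obtain y z r y' z' r' where p: "p = (y - z, r)" "y \<in> C" "\<phi> z \<le> r"
      and q: "q = (y' - z', r')" "y' \<in> C" "\<phi> z' \<le> r'" unfolding K_def by blast
    have "\<phi> (s *\<^sub>R z + t *\<^sub>R z') \<le> s * \<phi> z + t * \<phi> z'"
      using \<phi> st by (auto simp: convex_on_def)
    also have "\<dots> \<le> s * r + t * r'" using p q st by (intro add_mono mult_left_mono) auto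
    finally have "\<phi> (s *\<^sub>R z + t *\<^sub>R z') \<le> s * r + t * r'" .
    moreover have "s *\<^sub>R y + t *\<^sub>R y' \<in> C" using p q st \<open>convex C\<close> by (auto simp: convex_def)
    moreover have "s *\<^sub>R p + t *\<^sub>R q
        = ((s *\<^sub>R y + t *\<^sub>R y') - (s *\<^sub>R z + t *\<^sub>R z'), s * r + t * r')"
      using p q by (simp add: algebra_simps)
    ultimately show "s *\<^sub>R p + t *\<^sub>R q \<in> K" unfolding K_def by blast
  qed
  \<comment> \<open>3/2 is a Lipschitz constant of \<open>\<phi>\<close>, and \<open>\<phi>\<close>
    is nonnegative on \<open>C\<close>.\<close>
  moreover have lower: "- (3/2) * norm d \<le> r" if "(d, r) \<in> K" for d r
  proof -
    obtain y z where d: "d = y - z" "y \<in> C" "\<phi> z \<le> r" using \<open>(d, r) \<in> K\<close> by (auto simp: K_def)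
    have "norm (y - x) \<le> norm (z - x) + norm d" "norm (y - a) \<le> norm (z - a) + norm d"
      using norm_triangle_ineq[of "z - x" d] norm_triangle_ineq[of "z - a" d] by (auto simp: d)
    with a(2)[OF d(2)] d(3) show ?thesis by (simp add: \<phi>_def)
  qed
  ultimately have "\<exists>u::'a dual. \<forall>d r. (d, r) \<in> K \<longrightarrow> blinfun_apply u d \<le> r"
    by (intro hahn_banach_convex_set[of K "3/2"]) auto
  then obtain u :: "'a dual" where u: "\<And>d r. (d, r) \<in> K \<Longrightarrow> blinfun_apply u d \<le> r"
    by blast
  have "u (y - z) \<le> \<phi> z" if "y \<in> C" for y z
    using u[of "y - z" "\<phi> z"] that by (auto simp: K_def)
  note u = this
  have "(a, u) \<in> normal_cone C"
    using a(1) u[of _ a] by (auto simp: normal_cone_def \<phi>_def)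
  moreover have "u (a - x) \<le> norm (x - a) / 2 - norm (a - x)"
    using u[OF a(1), of x] by (simp add: \<phi>_def)
  moreover have "0 < norm (a - x)" using a(1) \<open>x \<notin> C\<close> by auto
  ultimately have "0 < u (x - a)"
    unfolding norm_minus_commute[of x a] blinfun.diff_right by linarith
  with \<open>(a, u) \<in> normal_cone C\<close> show ?thesis by blast
qed

subsection \<open>Fenchel duality\<close>

lemma zero_in_icD:
  assumes "0 \<in> ic S"
  shows "closed (span S)" "0 \<in> S" "\<And>v. v \<in> span S \<Longrightarrow> \<exists>\<delta>>0. \<forall>t\<in>{0..\<delta>}. t *\<^sub>R v \<in> S"
proof -
  have S: "closed (affine hull S)" "0 \<in> rel_algebraic_interior S"
    using assms by (auto simp: ic_def split: if_splits)
  then show "0 \<in> S" by (simp add: rel_algebraic_interior_def)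
  then have hull: "affine hull S = span S" by (intro affine_hull_span_0 hull_inc)
  show "closed (span S)" using S hull by simp
  show "\<exists>\<delta>>0. \<forall>t\<in>{0..\<delta>}. t *\<^sub>R v \<in> S" if "v \<in> span S" for v
    using S(2) that by (simp add: rel_algebraic_interior_def hull)
qed

text \<open>A neighbourhood of 0 absorbs every vector, so the affine hull is the whole space and in
  particular closed.\<close>

lemma zero_in_ic_interior:
  assumes "0 \<in> interior S"
  shows "0 \<in> ic S"
proof -
  obtain e where e: "0 < e" "ball 0 e \<subseteq> S" using assms by (auto simp: mem_interior)
  have absorb: "\<exists>\<delta>>0. \<forall>t\<in>{0..\<delta>}. t *\<^sub>R v \<in> S" for v
  proof (intro exI[of _ "e / (1 + norm v)"] conjI ballI)
    have pos: "0 < 1 + norm v" by (rule add_pos_nonneg) auto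
    then show "0 < e / (1 + norm v)" using e by simp
    fix t assume t: "t \<in> {0..e / (1 + norm v)}"
    then have "t * norm v < t * (1 + norm v) \<or> t = 0" by (auto simp: less_le)
    moreover have "t * (1 + norm v) \<le> e" using t pos by (simp add: field_simps)
    ultimately have "norm (t *\<^sub>R v) < e" using t e by auto
    then show "t *\<^sub>R v \<in> S" using e by auto
  qed
  have "v \<in> span S" for v
  proof -
    obtain \<delta> where "0 < \<delta>" "\<delta> *\<^sub>R v \<in> S" using absorb[of v] by force
    then have "inverse \<delta> *\<^sub>R (\<delta> *\<^sub>R v) \<in> span S" by (intro span_scale span_base)
    with \<open>0 < \<delta>\<close> show ?thesis by simp
  qed
  moreover have "0 \<in> S" using assms interior_subset by blast
  ultimately have "affine hull S = UNIV" by (simp add: affine_hull_span_0 hull_inc set_eq_iff)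
  with \<open>0 \<in> S\<close> absorb show ?thesis by (simp add: ic_def rel_algebraic_interior_def)
qed

text \<open>The weights (1/2)^(n+1) sum to 1. A partial sum whose missing mass (1/2)^n is put on any
  point of \<open>C\<close> is a genuine convex combination, and the limit stays in \<open>C\<close>
  by closedness.\<close>

lemma convex_series_mem:
  fixes C :: "'w::banach set"
  assumes "closed C" "convex C" "bounded C" and w: "\<And>n. w n \<in> C"
  shows "summable (\<lambda>n. (1/2) ^ Suc n *\<^sub>R w n)" "(\<Sum>n. (1/2) ^ Suc n *\<^sub>R w n) \<in> C"
proof -
  obtain R where R: "\<And>n. norm (w n) \<le> R" using \<open>bounded C\<close> w unfolding bounded_iff by blast
  have "summable (\<lambda>n. (1/2::real) ^ n * R)"
    by (intro summable_mult2 summable_geometric) simp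
  then show sm: "summable (\<lambda>n. (1/2) ^ Suc n *\<^sub>R w n)"
  proof (rule summable_comparison_test')
    fix n
    have "(1/2) ^ Suc n * norm (w n) \<le> (1/2) ^ n * R"
      by (intro mult_mono R) (auto intro: order_trans[OF norm_ge_zero R])
    then show "norm ((1/2) ^ Suc n *\<^sub>R w n) \<le> (1/2) ^ n * R" by simp
  qed
  have mem: "(\<Sum>k<n. (1/2) ^ Suc k *\<^sub>R w k) + (1/2) ^ n *\<^sub>R c \<in> C" if "c \<in> C" for n c
    using that
  proof (induction n arbitrary: c)
    case (Suc n)
    have "(1/2) *\<^sub>R w n + (1/2) *\<^sub>R c \<in> C"
      using Suc w \<open>convex C\<close> by (intro convexD) auto
    from Suc.IH[OF this] show ?case by (simp add: algebra_simps)
  qed simp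
  have "(\<lambda>n. (\<Sum>k<n. (1/2) ^ Suc k *\<^sub>R w k) + (1/2) ^ n *\<^sub>R w 0)
      \<longlonglongrightarrow> (\<Sum>n. (1/2) ^ Suc n *\<^sub>R w n) + 0 *\<^sub>R w 0"
    by (intro tendsto_intros summable_LIMSEQ sm LIMSEQ_power_zero) simp
  from closed_sequentially[OF \<open>closed C\<close> mem[OF w] this]
  show "(\<Sum>n. (1/2) ^ Suc n *\<^sub>R w n) \<in> C"
    by simp
qed

text \<open>Successive approximation removes the closure at the price of half the radius: each
  residual in the ball is \<open>T w\<close> plus half of another residual in the same ball, and the
  chosen points \<open>w\<close> are summed as a convex series in \<open>C\<close>.\<close>

lemma convex_image_ball_of_closure:
  fixes C :: "'w::banach set" and T :: "'w \<Rightarrow> 'a::real_normed_vector"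
  assumes C: "closed C" "convex C" "bounded C" and T: "bounded_linear T"
    and V: "subspace V" "T ` C \<subseteq> V"
    and ball: "ball 0 \<eta> \<inter> V \<subseteq> closure (T ` C)" "0 < \<eta>"
  shows "ball 0 (\<eta> / 2) \<inter> V \<subseteq> T ` C"
proof
  fix v assume v: "v \<in> ball 0 (\<eta> / 2) \<inter> V"
  interpret T: bounded_linear T by (rule T)
  define N where "N = ball 0 \<eta> \<inter> V"
  have step: "\<exists>r'. r' \<in> N \<and> (\<exists>w\<in>C. r = T w + (1/2) *\<^sub>R r')" if "r \<in> N" for r
  proof -
    have "r \<in> closure (T ` C)" using ball that by (auto simp: N_def)
    then obtain w where w: "w \<in> C" "dist (T w) r < \<eta> / 2"
      using \<open>0 < \<eta>\<close> unfolding closure_approachable by (auto dest!: spec[of _ "\<eta> / 2"])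
    have "2 *\<^sub>R (r - T w) \<in> N"
      using w that V by (auto simp: N_def dist_norm norm_minus_commute intro!: subspace_scale subspace_diff)
    then show ?thesis using w(1) by (intro exI[of _ "2 *\<^sub>R (r - T w)"]) auto
  qed
  \<comment> \<open>The iteration starts at twice \<open>v\<close> because the weights of the convex
    series begin with 1/2.\<close>
  have "2 *\<^sub>R v \<in> N" using v V by (auto simp: N_def intro: subspace_scale)
  have "\<exists>f. \<forall>n. (f n \<in> N \<and> (n = 0 \<longrightarrow> f n = 2 *\<^sub>R v)) \<and> (\<exists>w\<in>C. f n = T w + (1/2) *\<^sub>R f (Suc n))"
    using \<open>2 *\<^sub>R v \<in> N\<close> step by (intro dependent_nat_choice) auto
  then obtain f where f: "\<And>n. f n \<in> N" "f 0 = 2 *\<^sub>R v"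
    "\<And>n. \<exists>w\<in>C. f n = T w + (1/2) *\<^sub>R f (Suc n)" by blast
  then obtain w where w: "\<And>n. w n \<in> C" "\<And>n. f n = T (w n) + (1/2) *\<^sub>R f (Suc n)" by metis
  define s where "s = (\<Sum>n. (1/2) ^ Suc n *\<^sub>R w n)"
  have part: "v = (\<Sum>k<n. (1/2) ^ Suc k *\<^sub>R T (w k)) + (1/2) ^ Suc n *\<^sub>R f n" for n
  proof (induction n)
    case (Suc n)
    have "(1/2) ^ Suc n *\<^sub>R f n = (1/2) ^ Suc n *\<^sub>R T (w n) + (1/2) ^ Suc (Suc n) *\<^sub>R f (Suc n)"
      by (subst w(2)) (simp add: scaleR_add_right)
    with Suc show ?case by simp
  qed (simp add: f)
  have "(\<lambda>n. (1/2) ^ Suc n *\<^sub>R f n) \<longlonglongrightarrow> 0"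
  proof (rule Lim_null_comparison)
    show "\<forall>\<^sub>F n in sequentially. norm ((1/2) ^ Suc n *\<^sub>R f n) \<le> (1/2) ^ n * \<eta>"
    proof (intro always_eventually allI)
      fix n
      have "norm (f n) \<le> \<eta>" using f(1)[of n] by (auto simp: N_def)
      then have "(1/2) ^ Suc n * norm (f n) \<le> (1/2) ^ n * \<eta>"
        using \<open>0 < \<eta>\<close> by (intro mult_mono) auto
      then show "norm ((1/2) ^ Suc n *\<^sub>R f n) \<le> (1/2) ^ n * \<eta>" by simp
    qed
    have "(\<lambda>n. (1/2) ^ n * \<eta>) \<longlonglongrightarrow> 0 * \<eta>"
      by (intro tendsto_intros LIMSEQ_power_zero) simp
    then show "(\<lambda>n. (1/2) ^ n * \<eta>) \<longlonglongrightarrow> 0" by simp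
  qed
  from tendsto_diff[OF tendsto_const[of v] this]
  have "(\<lambda>n. v - (1/2) ^ Suc n *\<^sub>R f n) \<longlonglongrightarrow> v" by simp
  moreover have "v - (1/2) ^ Suc n *\<^sub>R f n = T (\<Sum>k<n. (1/2) ^ Suc k *\<^sub>R w k)" for n
    using part[of n] unfolding T.sum T.scaleR by (simp only: diff_eq_eq)
  ultimately have "(\<lambda>n. T (\<Sum>k<n. (1/2) ^ Suc k *\<^sub>R w k)) \<longlonglongrightarrow> v" by simp
  moreover have "(\<lambda>n. T (\<Sum>k<n. (1/2) ^ Suc k *\<^sub>R w k)) \<longlonglongrightarrow> T s"
    unfolding s_def by (intro T.tendsto summable_LIMSEQ convex_series_mem(1)[OF C] w)
  ultimately have "v = T s" by (rule LIMSEQ_unique)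
  moreover have "s \<in> C" unfolding s_def by (rule convex_series_mem(2)[OF C w(1)])
  ultimately show "v \<in> T ` C" by blast
qed

lemma convex_scaleR_mem:
  assumes "convex S" "0 \<in> S" "x \<in> S" "0 \<le> t" "t \<le> 1"
  shows "t *\<^sub>R x \<in> S"
  using convexD_alt[OF assms(1,2,3), of t] assms(4,5) by simp

text \<open>Baire's theorem and a convex series argument, as in the Robinson-Ursescu theorem.\<close>

lemma ball_subset_bounded_image:
  fixes K :: "'w::banach set" and T :: "'w \<Rightarrow> 'a::banach"
  assumes K: "closed K" "convex K" and T: "bounded_linear T" and ic: "0 \<in> ic (T ` K)"
  shows "\<exists>R \<eta>. 0 < \<eta> \<and> ball 0 \<eta> \<inter> span (T ` K) \<subseteq> T ` (K \<inter> cball 0 R)"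
proof -
  interpret T: bounded_linear T by (rule T)
  define V where "V = span (T ` K)"
  note V = zero_in_icD[OF ic, folded V_def]
  have sub: "subspace V" by (simp add: V_def)
  obtain w0 where w0: "w0 \<in> K" "T w0 = 0" using V(2) by auto
  define S where "S n = T ` (K \<inter> cball w0 (real n))" for n
  have convS: "convex (S n)" for n
    unfolding S_def using K(2) by (intro convex_linear_image T.linear convex_Int) auto
  have S0: "0 \<in> S n" for n unfolding S_def using w0 by (force intro!: image_eqI[of _ _ w0])
  have S_mono: "S m \<subseteq> S n" if "m \<le> n" for m n
    using that unfolding S_def by (intro image_mono Int_mono subset_cball) auto
  have SV: "S n \<subseteq> V" for n unfolding S_def V_def by (rule order_trans[OF image_mono[OF Int_lower1] span_superset])
  have absorb: "\<exists>n. 0 < n \<and> (1 / real n) *\<^sub>R v \<in> S n" if "v \<in> V" for v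
  proof -
    obtain \<delta> where \<delta>: "0 < \<delta>" "\<delta> *\<^sub>R v \<in> T ` K" using V(3)[OF \<open>v \<in> V\<close>] by (meson atLeastAtMost_iff less_imp_le order_refl)
    then obtain w where w: "w \<in> K" "\<delta> *\<^sub>R v = T w" by blast
    obtain n where n: "max (dist w0 w) (1 / \<delta>) < real n" using reals_Archimedean2 by blast
    then have "0 < real n" using zero_le_dist[of w0 w] by linarith
    have "T w \<in> S n" using w n by (auto simp: S_def)
    then have "(1 / (real n * \<delta>)) *\<^sub>R T w \<in> S n"
      using n \<delta> \<open>0 < real n\<close> by (intro convex_scaleR_mem convS S0) (auto simp: field_simps)
    then have "(1 / real n) *\<^sub>R v \<in> S n" using \<delta>(1) unfolding w(2)[symmetric] by simp
    then show ?thesis using \<open>0 < real n\<close> by auto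
  qed
  \<comment> \<open>The dilates of these closures cover the complete space \<open>V\<close>, so by
    Baire one of them has interior relative to \<open>V\<close>.\<close>
  define F where "F n = (\<lambda>v. real n *\<^sub>R v) ` closure (S n)" for n
  have clV: "closure (S n) \<subseteq> V" for n using SV V(1) by (simp add: closure_minimal)
  have F_closed: "closedin (top_of_set V) (F n)" for n
    using clV sub by (intro closed_subset) (auto simp: F_def closed_scaling intro: subspace_scale)
  have "V \<subseteq> (\<Union>n\<in>{0<..}. F n)"
  proof
    fix v assume "v \<in> V"
    then obtain n where n: "0 < n" "(1 / real n) *\<^sub>R v \<in> S n" using absorb by blast
    then have "real n *\<^sub>R ((1 / real n) *\<^sub>R v) \<in> F n"
      unfolding F_def using closure_subset by blast
    with n show "v \<in> (\<Union>n\<in>{0<..}. F n)" by auto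
  qed
  moreover have "F n \<subseteq> V" for n using F_closed closedin_subset by fastforce
  ultimately have V_eq: "\<Union> (F ` {0<..}) = V" by (simp add: UN_least subset_antisym)
  have "\<exists>n>0. top_of_set V interior_of F n \<noteq> {}"
  proof (rule ccontr)
    assume "\<not> ?thesis"
    then have "closedin (top_of_set V) T \<and> top_of_set V interior_of T = {}" if "T \<in> F ` {0<..}" for T
      using that F_closed by blast
    moreover have "completely_metrizable_space (top_of_set V)"
      using V(1) completely_metrizable_space_closedin[OF completely_metrizable_space_euclidean]
      unfolding closed_closedin by blast
    ultimately have "top_of_set V interior_of \<Union> (F ` {0<..}) = {}"
      by (intro Baire_category_alt) simp_all
    then have "V = {}"
      using interior_of_topspace[of "top_of_set V"] unfolding V_eq topspace_euclidean_subtopology by simp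
    with subspace_0[OF sub] show False by simp
  qed
  then obtain n v1 where n: "0 < n" and "v1 \<in> top_of_set V interior_of F n" by blast
  then obtain U where U: "openin (top_of_set V) U" "v1 \<in> U" "U \<subseteq> F n"
    by (auto simp: interior_of_def)
  then obtain e where e: "0 < e" "ball v1 e \<inter> V \<subseteq> U" "v1 \<in> V"
    using openin_contains_ball[of V U] openin_subset by force
  define v0 where "v0 = (1 / real n) *\<^sub>R v1"
  have v0: "v0 \<in> V" using e(3) sub by (simp add: v0_def subspace_scale)
  have near: "v0 + h \<in> closure (S n)" if "h \<in> V" "norm h < e / real n" for h
  proof -
    have "v1 + real n *\<^sub>R h \<in> ball v1 e \<inter> V"
      using that n e(3) sub by (auto simp: dist_norm field_simps intro!: subspace_add subspace_scale)
    then have "v1 + real n *\<^sub>R h \<in> F n" using e(2) U(3) by blast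
    then obtain s where s: "s \<in> closure (S n)" "v1 + real n *\<^sub>R h = real n *\<^sub>R s"
      unfolding F_def by blast
    then have "(1 / real n) *\<^sub>R (v1 + real n *\<^sub>R h) = s" using n by simp
    then have "v0 + h = s" using n by (simp add: v0_def scaleR_add_right)
    with s show ?thesis by simp
  qed
  \<comment> \<open>The ball found so far is centred at \<open>v0\<close>. A small multiple of
    \<open>- v0\<close> in the image is used to move it to 0: the weights 1/(1 + m) and m/(1 + m)
    below cancel \<open>v0\<close> and leave \<open>h\<close>, and the radius \<open>\<eta>\<close>
    is chosen so that (1 + m) \<open>h\<close> stays within e/n.\<close>
  obtain m where m: "0 < m" "(1 / real m) *\<^sub>R (- v0) \<in> S m"
    using absorb[of "- v0"] v0 sub by (auto simp: subspace_neg)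
  define N where "N = max n m"
  have cl_mono: "closure (S n) \<subseteq> closure (S N)" "S m \<subseteq> closure (S N)"
    using S_mono[of n N] S_mono[of m N] closure_subset by (auto simp: N_def closure_mono)
  define \<eta> where "\<eta> = e / real n / (1 + real m)"
  have "0 < \<eta>" using e n by (simp add: \<eta>_def)
  have "ball 0 \<eta> \<inter> V \<subseteq> closure (T ` (K \<inter> cball w0 (real N)))"
  proof
    fix h assume h: "h \<in> ball 0 \<eta> \<inter> V"
    then have "(1 + real m) * norm h < (1 + real m) * \<eta>" by simp
    also have "\<dots> = e / real n" by (simp add: \<eta>_def)
    finally have "norm ((1 + real m) *\<^sub>R h) < e / real n" by simp
    moreover have "(1 + real m) *\<^sub>R h \<in> V" using h sub by (blast intro: subspace_scale)
    ultimately have "v0 + (1 + real m) *\<^sub>R h \<in> closure (S N)"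
      using near cl_mono by blast
    moreover have "(1 / real m) *\<^sub>R (- v0) \<in> closure (S N)" using m cl_mono by auto
    ultimately have "(1 / (1 + real m)) *\<^sub>R (v0 + (1 + real m) *\<^sub>R h)
        + (real m / (1 + real m)) *\<^sub>R ((1 / real m) *\<^sub>R (- v0)) \<in> closure (S N)"
      using convS by (intro convexD[OF convex_closure]) (auto simp: add_divide_distrib[symmetric])
    moreover have "(1 / (1 + real m)) *\<^sub>R (v0 + (1 + real m) *\<^sub>R h)
        + (real m / (1 + real m)) *\<^sub>R ((1 / real m) *\<^sub>R (- v0)) = h"
      using m by (simp add: scaleR_add_right)
    ultimately show "h \<in> closure (T ` (K \<inter> cball w0 (real N)))" by (simp add: S_def)
  qed
  then have "ball 0 (\<eta> / 2) \<inter> V \<subseteq> T ` (K \<inter> cball w0 (real N))"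
    using SV[of N] K sub \<open>0 < \<eta>\<close>
    by (intro convex_image_ball_of_closure T) (auto simp: S_def convex_Int)
  moreover have "cball w0 (real N) \<subseteq> cball 0 (norm w0 + real N)"
  proof
    fix y assume "y \<in> cball w0 (real N)"
    then show "y \<in> cball 0 (norm w0 + real N)"
      using norm_triangle_sub[of y w0] by (simp add: dist_norm norm_minus_commute)
  qed
  ultimately have "ball 0 (\<eta> / 2) \<inter> V \<subseteq> T ` (K \<inter> cball 0 (norm w0 + real N))" by blast
  with \<open>0 < \<eta>\<close> show ?thesis unfolding V_def by (metis half_gt_zero)
qed

text \<open>The objective is linear because convex functions enter through epigraphs placed in
  \<open>K\<close>. The multiplier exists once \<open>\<rho> w - c\<close> is bounded below by a
  multiple of -norm(T w). This bound comes from openness: a point of \<open>K\<close> of bounded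
  norm, mapped opposite to \<open>T w\<close>, combines with \<open>w\<close> to a feasible point,
  where the hypothesis on the kernel applies.\<close>

theorem convex_duality:
  fixes K :: "'w::banach set" and T :: "'w \<Rightarrow> 'a::banach" and \<rho> :: "'w \<Rightarrow> real"
  assumes K: "closed K" "convex K" and T: "bounded_linear T" and \<rho>: "bounded_linear \<rho>"
    and ic: "0 \<in> ic (T ` K)" and ker: "\<And>w. w \<in> K \<Longrightarrow> T w = 0 \<Longrightarrow> c \<le> \<rho> w"
  shows "\<exists>u::'a dual. \<forall>w\<in>K. c + blinfun_apply u (T w) \<le> \<rho> w"
proof -
  interpret T: bounded_linear T by (rule T)
  interpret \<rho>: bounded_linear \<rho> by (rule \<rho>)
  obtain R \<eta> where \<eta>: "0 < \<eta>" "ball 0 \<eta> \<inter> span (T ` K) \<subseteq> T ` (K \<inter> cball 0 R)"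
    using ball_subset_bounded_image[OF K T ic] by blast
  obtain M0 where M0: "\<And>w. norm (\<rho> w) \<le> norm w * M0" "0 \<le> M0" using \<rho>.nonneg_bounded by blast
  define M where "M = \<bar>R\<bar> * M0 + \<bar>c\<bar>"
  have M: "\<rho> w - c \<le> M" if "w \<in> cball 0 R" for w
  proof -
    have "norm w * M0 \<le> \<bar>R\<bar> * M0" using that M0 by (intro mult_right_mono) auto
    with M0(1)[of w] show ?thesis by (simp add: M_def)
  qed
  have "0 \<le> M" using M0 by (simp add: M_def)
  define C where "C = (\<lambda>w. (T w, \<rho> w - c)) ` K"
  have "convex C"
  proof (rule convexI)
    fix p q and s t :: real
    assume "p \<in> C" "q \<in> C" and st: "0 \<le> s" "0 \<le> t" "s + t = 1"
    then obtain v w where p: "p = (T v, \<rho> v - c)" "v \<in> K" and q: "q = (T w, \<rho> w - c)" "w \<in> K"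
      by (auto simp: C_def)
    have "s * c + t * c = c" using st by (simp flip: distrib_right)
    then have "s *\<^sub>R p + t *\<^sub>R q = (T (s *\<^sub>R v + t *\<^sub>R w), \<rho> (s *\<^sub>R v + t *\<^sub>R w) - c)"
      by (simp add: p q T.add T.scaleR \<rho>.add \<rho>.scaleR algebra_simps)
    moreover have "s *\<^sub>R v + t *\<^sub>R w \<in> K" using K st p q by (simp add: convexD)
    ultimately show "s *\<^sub>R p + t *\<^sub>R q \<in> C" unfolding C_def by blast
  qed
  moreover have "- (2 * M / \<eta>) * norm d \<le> r" if "(d, r) \<in> C" for d r
  proof (cases "d = 0")
    case True
    then show ?thesis using that ker by (auto simp: C_def)
  next
    case False
    obtain w where w: "w \<in> K" "d = T w" "r = \<rho> w - c" using \<open>(d, r) \<in> C\<close> by (auto simp: C_def)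
    \<comment> \<open>With this \<open>t\<close>, the vector \<open>- (t *\<^sub>R d)\<close> has
      norm half of \<open>\<eta>\<close>. It therefore has a preimage in the bounded part of
      \<open>K\<close>, where \<open>\<rho> - c\<close> is at most \<open>M\<close>; this is the
      source of the constant 2M/\<open>\<eta>\<close>.\<close>
    define t where "t = \<eta> / (2 * norm d)"
    have t: "0 < t" using \<eta> False by (simp add: t_def)
    have "d \<in> span (T ` K)" using w by (auto intro: span_base)
    then have "- (t *\<^sub>R d) \<in> span (T ` K)" by (intro span_neg span_scale)
    moreover have "- (t *\<^sub>R d) \<in> ball 0 \<eta>" using \<eta> t False by (simp add: t_def)
    ultimately obtain v where v: "v \<in> K" "v \<in> cball 0 R" "T v = - (t *\<^sub>R d)" using \<eta>(2) by force
    define x where "x = (1 / (1 + t)) *\<^sub>R v + (t / (1 + t)) *\<^sub>R w"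
    have "x \<in> K"
      unfolding x_def using K v w t
      by (intro convexD) (auto simp: add_divide_distrib[symmetric])
    moreover have "T x = 0" using v w t by (simp add: x_def T.add T.scaleR)
    ultimately have "c \<le> \<rho> x" by (rule ker)
    also have "\<rho> x = (\<rho> v + t * \<rho> w) / (1 + t)"
      by (simp add: x_def \<rho>.add \<rho>.scaleR add_divide_distrib)
    finally have "c * (1 + t) \<le> \<rho> v + t * \<rho> w" using t by (simp add: pos_le_divide_eq)
    then have "0 \<le> (\<rho> v - c) + t * r" by (simp add: w algebra_simps)
    with M[OF v(2)] have "0 \<le> M + t * r" by linarith
    then have "- M / t \<le> r" using t by (simp add: field_simps)
    moreover have "M / t = 2 * M / \<eta> * norm d" using \<eta> False by (simp add: t_def)
    ultimately show ?thesis by simp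
  qed
  ultimately obtain u :: "'a dual" where "\<forall>d r. (d, r) \<in> C \<longrightarrow> blinfun_apply u d \<le> r"
    using hahn_banach_convex_set[of C "2 * M / \<eta>"] \<open>0 \<le> M\<close> \<eta>(1) by auto
  then show ?thesis by (intro exI[of _ u]) (force simp: C_def)
qed

subsection \<open>Monotone operators and Fitzpatrick functions\<close>

lemma pairing_diff: "pairing (z - w) = pairing z - coupling z w + pairing w"
  by (simp add: pairing_def coupling_def blinfun.diff_left blinfun.diff_right)

lemma coupling_self: "coupling z z = 2 * pairing z"
  by (simp add: pairing_def coupling_def)

lemma coupling_combination:
  "coupling (s *\<^sub>R z + t *\<^sub>R w) a = s * coupling z a + t * coupling w a"
  by (simp add: coupling_def blinfun.add_left blinfun.scaleR_left blinfun.add_right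
      blinfun.scaleR_right algebra_simps)

lemma maximal_monotone_memI:
  assumes A: "maximal_monotone A" and z: "\<And>a. a \<in> A \<Longrightarrow> 0 \<le> pairing (z - a)"
  shows "z \<in> A"
proof -
  have sym: "pairing (a - z) = pairing (z - a)" for a
    by (simp add: pairing_def blinfun.diff_left blinfun.diff_right)
  have zero: "pairing (0 :: 'a \<times> 'a dual) = 0" by (simp add: pairing_def)
  have "0 \<le> pairing (a - b)" if "a \<in> insert z A" "b \<in> insert z A" for a b
  proof (cases "a = z \<or> b = z")
    case True
    then show ?thesis using that z sym zero by (metis diff_self insertE order_refl)
  next
    case False
    then show ?thesis using that A by (simp add: maximal_monotone_def monotone_operator_def)
  qed
  then have "monotone_operator (insert z A)" by (simp add: monotone_operator_def)
  then have "insert z A = A" using A unfolding maximal_monotone_def by (simp add: subset_insertI)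
  then show ?thesis by blast
qed

lemma maximal_monotone_nonempty:
  assumes "maximal_monotone A"
  shows "A \<noteq> {}"
  using maximal_monotone_memI[OF assms] by blast

lemma monotone_operator_sum:
  assumes "monotone_operator A" "monotone_operator B"
  shows "monotone_operator (operator_sum A B)"
  unfolding monotone_operator_def
proof (intro ballI)
  fix m m' assume "m \<in> operator_sum A B" "m' \<in> operator_sum A B"
  then obtain x a b x' a' b' where "m = (x, a + b)" "(x, a) \<in> A" "(x, b) \<in> B"
    and "m' = (x', a' + b')" "(x', a') \<in> A" "(x', b') \<in> B"
    unfolding operator_sum_def by blast
  moreover from this have "0 \<le> pairing ((x, a) - (x', a'))" "0 \<le> pairing ((x, b) - (x', b'))"
    using assms unfolding monotone_operator_def by blast+
  ultimately show "0 \<le> pairing (m - m')"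
    by (simp add: pairing_def blinfun.diff_left blinfun.add_left)
qed

text \<open>The epigraph of the Fitzpatrick function over real heights. Being an intersection of
  closed half-spaces of a normed space, it is closed and convex, and so a suitable input for
  \<open>convex_duality\<close>; extended reals are avoided.\<close>

definition fitzpatrick_epi :: "'a::real_normed_vector operator \<Rightarrow> (('a \<times> 'a dual) \<times> real) set" where
  "fitzpatrick_epi A = {(z, r). \<forall>a\<in>A. coupling z a - pairing a \<le> r}"

lemma fitzpatrick_le_iff: "fitzpatrick A z \<le> ereal r \<longleftrightarrow> (z, r) \<in> fitzpatrick_epi A"
  by (simp add: fitzpatrick_def fitzpatrick_epi_def SUP_le_iff)

lemma effective_domain_fitzpatrick:
  "effective_domain (fitzpatrick A) = fst ` fitzpatrick_epi A"
proof -
  have "fitzpatrick A z < \<infinity> \<longleftrightarrow> (\<exists>r. (z, r) \<in> fitzpatrick_epi A)" for z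
    unfolding fitzpatrick_le_iff[symmetric] by (cases "fitzpatrick A z") auto
  then show ?thesis by (force simp: effective_domain_def)
qed

lemma closed_fitzpatrick_epi: "closed (fitzpatrick_epi A)"
proof -
  have "fitzpatrick_epi A = (\<Inter>a\<in>A. {w. coupling (fst w) a - pairing a \<le> snd w})"
    by (auto simp: fitzpatrick_epi_def)
  moreover have "closed {w. coupling (fst w) a - pairing a \<le> snd w}" for a :: "'a \<times> 'a dual"
    unfolding coupling_def by (intro closed_Collect_le continuous_intros)
  ultimately show ?thesis by (simp add: closed_INT)
qed

lemma convex_fitzpatrick_epi: "convex (fitzpatrick_epi A)"
proof (rule convexI)
  fix v w and s t :: real
  assume v: "v \<in> fitzpatrick_epi A" and w: "w \<in> fitzpatrick_epi A" and st: "0 \<le> s" "0 \<le> t" "s + t = 1"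
  have "coupling (s *\<^sub>R fst v + t *\<^sub>R fst w) a - pairing a \<le> s * snd v + t * snd w" if "a \<in> A" for a
  proof -
    have "s * (coupling (fst v) a - pairing a) + t * (coupling (fst w) a - pairing a)
        \<le> s * snd v + t * snd w"
      using v w st that by (intro add_mono mult_left_mono) (auto simp: fitzpatrick_epi_def)
    moreover have "s * pairing a + t * pairing a = pairing a"
      using st by (simp flip: distrib_right)
    ultimately show ?thesis by (simp add: coupling_combination right_diff_distrib)
  qed
  then show "s *\<^sub>R v + t *\<^sub>R w \<in> fitzpatrick_epi A"
    by (cases v; cases w) (simp add: fitzpatrick_epi_def)
qed

lemma monotone_mem_epi:
  assumes "monotone_operator A" "z \<in> A"
  shows "(z, pairing z) \<in> fitzpatrick_epi A"
  using assms unfolding monotone_operator_def fitzpatrick_epi_def by (force simp: pairing_diff)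

text \<open>Fitzpatrick's inequality. At a point of \<open>A\<close> the supremum is tested with the
  point itself; off \<open>A\<close>, maximality supplies \<open>a\<close> with p(z - a) < 0, that
  is, z.a - p(a) > p(z).\<close>

lemma maximal_monotone_epi_ge:
  assumes "maximal_monotone A" "(z, r) \<in> fitzpatrick_epi A"
  shows "pairing z \<le> r"
proof (cases "z \<in> A")
  case True
  then show ?thesis using assms(2) by (auto simp: fitzpatrick_epi_def coupling_self dest!: bspec)
next
  case False
  then obtain a where "a \<in> A" "pairing (z - a) < 0"
    using maximal_monotone_memI[OF assms(1)] by (meson not_le)
  with assms(2) show ?thesis by (force simp: fitzpatrick_epi_def pairing_diff)
qed

lemma NI_type_iff:
  "NI_type M \<longleftrightarrow> M \<noteq> {} \<and> (\<forall>z r. (z, r) \<in> fitzpatrick_epi M \<longrightarrow> pairing z \<le> r)"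
proof -
  have "ereal (pairing z) \<le> fitzpatrick M z \<longleftrightarrow> (\<forall>r. fitzpatrick M z \<le> ereal r \<longrightarrow> pairing z \<le> r)" for z
    by (cases "fitzpatrick M z") (auto intro: order_trans gt_ex lt_ex simp: not_le dest: spec[of _ "pairing z - 1"])
  then show ?thesis unfolding NI_type_def fitzpatrick_le_iff by blast
qed

lemma fst_effective_domain_superset:
  assumes "monotone_operator A"
  shows "Domain A \<subseteq> fst ` effective_domain (fitzpatrick A)"
  using monotone_mem_epi[OF assms] unfolding effective_domain_fitzpatrick by force

section \<open>Absorption of normal cones and the NI property of sums\<close>

lemma normal_cone_scale:
  assumes "(a, n) \<in> normal_cone C" "0 \<le> t"
  shows "(a, t *\<^sub>R n) \<in> normal_cone C"
  using assms by (auto simp: normal_cone_def blinfun.scaleR_left mult_nonneg_nonpos)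

text \<open>Adding \<open>n\<close> changes the pairing with a point of \<open>A\<close> over y by
  n(x - y), which is nonnegative. The new point remains monotonically related to \<open>A\<close>,
  so maximality absorbs it.\<close>

lemma maximal_monotone_add_normal_cone:
  assumes A: "maximal_monotone A" and a: "(x, a) \<in> A" and n: "(x, n) \<in> normal_cone (Domain A)"
  shows "(x, a + n) \<in> A"
proof (rule maximal_monotone_memI[OF A])
  fix w assume w: "w \<in> A"
  obtain y b where wy: "w = (y, b)" by (cases w)
  have "0 \<le> pairing ((x, a) - w)"
    using A a w by (simp add: maximal_monotone_def monotone_operator_def)
  moreover have "blinfun_apply n (y - x) \<le> 0" using n w wy by (auto simp: normal_cone_def)
  ultimately show "0 \<le> pairing ((x, a + n) - w)"
    by (simp add: wy pairing_def blinfun.diff_left blinfun.add_left blinfun.diff_right)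
qed

lemma ex_mult_gt:
  fixes p q :: real
  assumes "0 < q"
  shows "\<exists>t\<ge>0. p < t * q"
  using assms by (intro exI[of _ "(\<bar>p\<bar> + 1) / q"]) auto

text \<open>If \<open>x\<close> lies outside the domain, a normal vector \<open>n\<close> at some
  \<open>y\<close> is positive on x - y. Every positive multiple of \<open>n\<close> can be added to
  a value at \<open>y\<close>, which drives the Fitzpatrick function at any point over
  \<open>x\<close> to infinity. Conditions on closed convex domains thereby become conditions on
  projections of effective domains.\<close>

lemma fst_effective_domain_fitzpatrick:
  fixes A :: "'a::banach operator"
  assumes A: "maximal_monotone A" and D: "closed (Domain A)" "convex (Domain A)"
  shows "fst ` effective_domain (fitzpatrick A) = Domain A"
proof
  show "fst ` effective_domain (fitzpatrick A) \<subseteq> Domain A"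
  proof (rule ccontr)
    assume "\<not> ?thesis"
    then obtain x x' r where epi: "((x, x'), r) \<in> fitzpatrick_epi A" and x: "x \<notin> Domain A"
      unfolding effective_domain_fitzpatrick by force
    have "Domain A \<noteq> {}" using maximal_monotone_nonempty[OF A] by (simp add: Domain_empty_iff)
    then obtain y n where n: "(y, n) \<in> normal_cone (Domain A)" "0 < blinfun_apply n (x - y)"
      using normal_cone_separates[OF D _ x] by blast
    then obtain a where a: "(y, a) \<in> A" by (auto simp: normal_cone_def)
    obtain t where t: "0 \<le> t" "r - blinfun_apply x' y - blinfun_apply a (x - y) < t * blinfun_apply n (x - y)"
      using ex_mult_gt[OF n(2)] by blast
    have "(y, a + t *\<^sub>R n) \<in> A"
      using maximal_monotone_add_normal_cone[OF A a] normal_cone_scale[OF n(1) t(1)] by blast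
    with epi have "coupling (x, x') (y, a + t *\<^sub>R n) - pairing (y, a + t *\<^sub>R n) \<le> r"
      by (auto simp: fitzpatrick_epi_def)
    with t(2) show False
      by (simp add: coupling_def pairing_def blinfun.add_left blinfun.scaleR_left
          blinfun.diff_right algebra_simps)
  qed
qed (use A in \<open>auto simp: maximal_monotone_def intro!: fst_effective_domain_superset\<close>)

theorem NI_type_operator_sum:
  fixes A B :: "'a::banach operator"
  assumes A: "maximal_monotone A" and B: "maximal_monotone B"
    and C: "Domain A \<inter> Domain B \<noteq> {}" "closed (Domain A \<inter> Domain B)" "convex (Domain A \<inter> Domain B)"
    and N: "normal_cone (Domain A \<inter> Domain B)
      \<subseteq> operator_sum (normal_cone (Domain A)) (normal_cone (Domain B))"
  shows "NI_type (operator_sum A B)"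
  unfolding NI_type_iff
proof (intro conjI allI impI)
  show "operator_sum A B \<noteq> {}" using C(1) unfolding operator_sum_def by blast
next
  fix z r assume epi: "(z, r) \<in> fitzpatrick_epi (operator_sum A B)"
  obtain x x' where z: "z = (x, x')" by (cases z)
  \<comment> \<open>The bound h_M(z) <= r for the sum M, rewritten with the quadratic p; a single m
    with p(z - m) <= 0 suffices for the goal.\<close>
  have le: "pairing z - r \<le> pairing (z - m)" if "m \<in> operator_sum A B" for m
    using epi that by (force simp: fitzpatrick_epi_def pairing_diff)
  show "pairing z \<le> r"
  proof (cases "x \<in> Domain A \<inter> Domain B")
    case True
    then obtain a b where "(x, a) \<in> A" "(x, b) \<in> B" by blast
    then have "(x, a + b) \<in> operator_sum A B" unfolding operator_sum_def by blast
    from le[OF this] show ?thesis by (simp add: z pairing_def)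
  next
    case False
    then obtain y n where n: "(y, n) \<in> normal_cone (Domain A \<inter> Domain B)" "0 < blinfun_apply n (x - y)"
      using normal_cone_separates[OF C(2,3,1)] by blast
    then obtain n1 n2 where n12: "n = n1 + n2" "(y, n1) \<in> normal_cone (Domain A)"
      "(y, n2) \<in> normal_cone (Domain B)"
      using N unfolding operator_sum_def by blast
    then obtain a b where a: "(y, a) \<in> A" and b: "(y, b) \<in> B" by (auto simp: normal_cone_def)
    obtain t where t: "0 \<le> t" "r - pairing z + blinfun_apply (x' - a - b) (x - y) < t * blinfun_apply n (x - y)"
      using ex_mult_gt[OF n(2)] by blast
    \<comment> \<open>Each operator absorbs its own share of the normal vector, so the sum absorbs
      all of \<open>t *\<^sub>R n\<close>.\<close>
    have "(y, a + t *\<^sub>R n1) \<in> A" "(y, b + t *\<^sub>R n2) \<in> B"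
      using maximal_monotone_add_normal_cone[OF A a] maximal_monotone_add_normal_cone[OF B b]
        normal_cone_scale[OF _ t(1)] n12 by blast+
    then have "(y, (a + t *\<^sub>R n1) + (b + t *\<^sub>R n2)) \<in> operator_sum A B"
      unfolding operator_sum_def by blast
    from le[OF this] have "pairing z - r \<le> blinfun_apply (x' - a - b) (x - y) - t * blinfun_apply n (x - y)"
      by (simp add: z pairing_def n12(1) blinfun.diff_left blinfun.add_left blinfun.scaleR_left algebra_simps)
    with t(2) show ?thesis by simp
  qed
qed

section \<open>Normal cones of intersections and maximality of sums\<close>

lemma difference_set_eq_image: "difference_set S T = (\<lambda>w. fst w - snd w) ` (S \<times> T)"
  by (force simp: difference_set_def)

text \<open>Normality of \<open>n\<close> says that -n is minimal at \<open>a\<close> over the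
  intersection. Duality for the constraint y = y' on pairs from \<open>C\<close> and
  \<open>D\<close> gives a multiplier \<open>u\<close>. Fixing y' = a shows that n + u is normal to
  \<open>C\<close>, and fixing y = a shows that -u is normal to \<open>D\<close>.\<close>

lemma normal_cone_Int:
  fixes C D :: "'a::banach set"
  assumes C: "closed C" "convex C" and D: "closed D" "convex D"
    and ic: "0 \<in> ic (difference_set C D)"
  shows "normal_cone (C \<inter> D) \<subseteq> operator_sum (normal_cone C) (normal_cone D)"
proof clarify
  fix a and n :: "'a dual" assume n: "(a, n) \<in> normal_cone (C \<inter> D)"
  then have a: "a \<in> C" "a \<in> D" by (auto simp: normal_cone_def)
  have "\<exists>u::'a dual. \<forall>w\<in>C \<times> D. - n a + u (fst w - snd w) \<le> - n (fst w)"
  proof (rule convex_duality)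
    show "closed (C \<times> D)" "convex (C \<times> D)" using C D by (auto intro: closed_Times convex_Times)
    show "bounded_linear (\<lambda>w. fst w - snd w :: 'a)" "bounded_linear (\<lambda>w::'a \<times> 'a. - n (fst w))"
      by (intro bounded_linear_minus bounded_linear_intros)+
    show "0 \<in> ic ((\<lambda>w. fst w - snd w) ` (C \<times> D))" using ic by (simp add: difference_set_eq_image)
    show "- n a \<le> - n (fst w)" if "w \<in> C \<times> D" "fst w - snd w = 0" for w
      using n that by (auto simp: normal_cone_def blinfun.diff_right dest!: bspec[of _ _ "fst w"])
  qed
  then obtain u :: "'a dual" where u: "\<And>y y'. y \<in> C \<Longrightarrow> y' \<in> D \<Longrightarrow> - n a + u (y - y') \<le> - n y"
    by force
  have "(a, n + u) \<in> normal_cone C"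
    using u[OF _ a(2)] a by (force simp: normal_cone_def blinfun.diff_right blinfun.add_left)
  moreover have "(a, - u) \<in> normal_cone D"
    using u[OF a(1)] a by (auto simp: normal_cone_def blinfun.diff_right blinfun.minus_left)
  moreover have "n = (n + u) + - u" by simp
  ultimately show "(a, n) \<in> operator_sum (normal_cone C) (normal_cone D)"
    unfolding operator_sum_def by blast
qed

text \<open>The convex function \<open>h\<^sub>M\<close> lies above the quadratic \<open>p\<close> and touches it at \<open>z\<close>, so it lies above
  the linearization of \<open>p\<close> at \<open>z\<close>.\<close>

lemma NI_type_fitzpatrick_epi_ge:
  assumes NI: "NI_type M" and z: "(z, pairing z) \<in> fitzpatrick_epi M" and w: "(w, r) \<in> fitzpatrick_epi M"
  shows "coupling z w - pairing z \<le> r"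
proof -
  have sym: "coupling w z = coupling z w" by (simp add: coupling_def)
  \<comment> \<open>The NI inequality at a point of the segment from \<open>z\<close> to
    \<open>w\<close>, divided by \<open>t\<close>. Only the term t p(w - z) depends on
    \<open>t\<close>, and it vanishes as \<open>t\<close> decreases to 0.\<close>
  have ineq: "coupling z w - 2 * pairing z + t * pairing (w - z) \<le> r - pairing z" if t: "0 < t" "t < 1" for t
  proof -
    have "(1 - t) *\<^sub>R (z, pairing z) + t *\<^sub>R (w, r) \<in> fitzpatrick_epi M"
      using t by (intro convexD[OF convex_fitzpatrick_epi] z w) auto
    then have "((1 - t) *\<^sub>R z + t *\<^sub>R w, (1 - t) * pairing z + t * r) \<in> fitzpatrick_epi M" by simp
    then have "pairing ((1 - t) *\<^sub>R z + t *\<^sub>R w) \<le> (1 - t) * pairing z + t * r"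
      using NI unfolding NI_type_iff by blast
    moreover have "pairing ((1 - t) *\<^sub>R z + t *\<^sub>R w)
        = pairing z + t * (coupling z w - 2 * pairing z) + t * (t * pairing (w - z))"
      by (simp add: pairing_def coupling_def blinfun.add_left blinfun.add_right blinfun.scaleR_left
          blinfun.scaleR_right blinfun.diff_left blinfun.diff_right algebra_simps)
    ultimately have "t * (coupling z w - 2 * pairing z + t * pairing (w - z)) \<le> t * (r - pairing z)"
      by (simp add: algebra_simps)
    with t show ?thesis by simp
  qed
  have "((\<lambda>t. coupling z w - 2 * pairing z + t * pairing (w - z)) \<longlongrightarrow>
      coupling z w - 2 * pairing z + 0 * pairing (w - z)) (at_right 0)"
    by (intro tendsto_intros)
  moreover have "\<forall>\<^sub>F t in at_right 0. coupling z w - 2 * pairing z + t * pairing (w - z) \<le> r - pairing z"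
    using ineq eventually_at_right_less[of "0::real"]
    by (auto simp: eventually_at_right_field intro!: exI[of _ 1])
  ultimately have "coupling z w - 2 * pairing z + 0 * pairing (w - z) \<le> r - pairing z"
    by (intro tendsto_upperbound) auto
  then show ?thesis by simp
qed

theorem maximal_monotone_operator_sum:
  fixes A B :: "'a::banach operator"
  assumes A: "maximal_monotone A" and B: "maximal_monotone B" and NI: "NI_type (operator_sum A B)"
    and ic: "0 \<in> ic (difference_set (fst ` effective_domain (fitzpatrick A))
      (fst ` effective_domain (fitzpatrick B)))"
  shows "maximal_monotone (operator_sum A B)"
proof -
  let ?M = "operator_sum A B"
  have monA: "monotone_operator A" and monB: "monotone_operator B"
    using A B by (simp_all add: maximal_monotone_def)
  have "z \<in> ?M" if z: "(z, pairing z) \<in> fitzpatrick_epi ?M" for z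
  proof -
    obtain x x' where zx: "z = (x, x')" by (cases z)
    \<comment> \<open>\<open>?T\<close> compares the base points of two epigraph points.
      \<open>?\<rho>\<close> is the sum of their heights minus the terms of the coupling of
      \<open>z\<close> with the combined point, so on the kernel of \<open>?T\<close> the bound
      -p(z) is the tight NI inequality.\<close>
    let ?T = "\<lambda>w::(('a \<times> 'a dual) \<times> real) \<times> (('a \<times> 'a dual) \<times> real).
      fst (fst (fst w)) - fst (fst (snd w))"
    let ?\<rho> = "\<lambda>w::(('a \<times> 'a dual) \<times> real) \<times> (('a \<times> 'a dual) \<times> real).
      snd (fst w) + snd (snd w) - blinfun_apply (snd (fst (fst w))) x
        - blinfun_apply (snd (fst (snd w))) x - blinfun_apply x' (fst (fst (fst w)))"
    let ?K = "fitzpatrick_epi A \<times> fitzpatrick_epi B"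
    have "\<exists>u::'a dual. \<forall>w\<in>?K. - pairing z + blinfun_apply u (?T w) \<le> ?\<rho> w"
    proof (rule convex_duality)
      show "closed ?K" "convex ?K"
        by (auto intro!: closed_Times convex_Times closed_fitzpatrick_epi convex_fitzpatrick_epi)
      show "bounded_linear ?T" "bounded_linear ?\<rho>"
        by (intro bounded_linear_intros)+
      show "0 \<in> ic (?T ` ?K)"
      proof -
        have "?T ` ?K = difference_set (fst ` effective_domain (fitzpatrick A))
            (fst ` effective_domain (fitzpatrick B))"
          unfolding difference_set_def effective_domain_fitzpatrick by force
        with ic show ?thesis by simp
      qed
      fix w assume "w \<in> ?K" and T0: "?T w = 0"
      then obtain y y' r y1 v' s where w: "w = (((y, y'), r), ((y1, v'), s))"
        and epi: "((y, y'), r) \<in> fitzpatrick_epi A" "((y1, v'), s) \<in> fitzpatrick_epi B"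
        by (cases w) auto
      have "y1 = y" using T0 by (simp add: w)
      \<comment> \<open>Over a common base point, heights above h_A and h_B add up to a height above
        the Fitzpatrick function of the sum.\<close>
      have "((y, y' + v'), r + s) \<in> fitzpatrick_epi ?M"
        unfolding fitzpatrick_epi_def
      proof clarsimp
        fix m m' assume "(m, m') \<in> ?M"
        then obtain a b where ab: "m' = a + b" "(m, a) \<in> A" "(m, b) \<in> B"
          unfolding operator_sum_def by blast
        then have "coupling (y, y') (m, a) - pairing (m, a) \<le> r" "coupling (y, v') (m, b) - pairing (m, b) \<le> s"
          using epi \<open>y1 = y\<close> by (auto simp: fitzpatrick_epi_def)
        then show "coupling (y, y' + v') (m, m') - pairing (m, m') \<le> r + s"
          by (simp add: ab(1) coupling_def pairing_def blinfun.add_left)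
      qed
      from NI_type_fitzpatrick_epi_ge[OF NI z this] show "- pairing z \<le> ?\<rho> w"
        by (simp add: w zx coupling_def blinfun.add_left)
    qed
    then obtain u :: "'a dual" where u: "\<And>w. w \<in> ?K \<Longrightarrow> - pairing z + blinfun_apply u (?T w) \<le> ?\<rho> w"
      by blast
    \<comment> \<open>The duality inequality at the epigraph points (a, p(a)) and (b, p(b)) regroups
      into two pairings that involve \<open>a\<close> and \<open>b\<close> separately.\<close>
    have sum: "0 \<le> pairing ((x, x' + u) - a) + pairing ((x, - u) - b)" if "a \<in> A" "b \<in> B" for a b
      using u[of "((a, pairing a), (b, pairing b))"] monotone_mem_epi[OF monA that(1)]
        monotone_mem_epi[OF monB that(2)]
      by (simp add: zx pairing_def blinfun.diff_left blinfun.diff_right blinfun.add_left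
          blinfun.minus_left algebra_simps)
    \<comment> \<open>A maximal monotone set always makes one of the two summands nonpositive:
      through the point itself if it belongs to the set, and through a violated inequality
      otherwise. Hence the other summand is nonnegative for every point of its operator.\<close>
    have witness: "\<exists>c\<in>C. pairing (w - c) \<le> 0" if "maximal_monotone C" for C and w :: "'a \<times> 'a dual"
    proof (cases "w \<in> C")
      case True
      then show ?thesis by (intro bexI[of _ w]) (auto simp: pairing_def)
    next
      case False
      then show ?thesis using maximal_monotone_memI[OF that] by (meson le_cases)
    qed
    have "(x, x' + u) \<in> A"
    proof (rule maximal_monotone_memI[OF A])
      fix a assume "a \<in> A"
      obtain b where "b \<in> B" "pairing ((x, - u) - b) \<le> 0" using witness[OF B] by blast
      with sum[OF \<open>a \<in> A\<close>, of b] show "0 \<le> pairing ((x, x' + u) - a)" by linarith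
    qed
    moreover have "(x, - u) \<in> B"
    proof (rule maximal_monotone_memI[OF B])
      fix b assume "b \<in> B"
      obtain a where "a \<in> A" "pairing ((x, x' + u) - a) \<le> 0" using witness[OF A] by blast
      with sum[OF _ \<open>b \<in> B\<close>, of a] show "0 \<le> pairing ((x, - u) - b)" by linarith
    qed
    moreover have "x' = (x' + u) + - u" by simp
    ultimately show ?thesis unfolding zx operator_sum_def by blast
  qed
  \<comment> \<open>A point of a monotone extension is monotonically related to the sum, so the
    first part places it in the sum.\<close>
  moreover have "(z, pairing z) \<in> fitzpatrick_epi ?M"
    if "monotone_operator N" "?M \<subseteq> N" "z \<in> N" for N z
    using monotone_mem_epi[OF that(1,3)] that(2) by (auto simp: fitzpatrick_epi_def)
  ultimately show ?thesis
    using monotone_operator_sum[OF monA monB] unfolding maximal_monotone_def by blast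
qed

subsection \<open>Interior of the domain\<close>

lemma interior_difference_set:
  fixes S T :: "'a::real_normed_vector set"
  assumes x: "x \<in> S" "x \<in> interior T"
  shows "0 \<in> interior (difference_set S T)" "0 \<in> interior (difference_set T S)"
proof -
  obtain e where e: "0 < e" "ball x e \<subseteq> T" using x(2) by (auto simp: mem_interior)
  have "h \<in> difference_set S T" "h \<in> difference_set T S" if "h \<in> ball 0 e" for h
  proof -
    have "x - h \<in> T" "x + h \<in> T" using e that by (auto simp: dist_norm subset_iff)
    moreover have "h = x - (x - h)" "h = (x + h) - x" by auto
    ultimately show "h \<in> difference_set S T" "h \<in> difference_set T S"
      using x(1) unfolding difference_set_def by blast+
  qed
  then show "0 \<in> interior (difference_set S T)" "0 \<in> interior (difference_set T S)"
    using e(1) by (auto simp: mem_interior)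
qed

text \<open>Over the fixed base point \<open>x\<close>, Fitzpatrick's inequality says that the
  height minus the value of the functional at \<open>x\<close> is nonnegative. The multiplier
  \<open>u\<close> of this constrained problem makes (x, u) monotonically related to
  \<open>B\<close>. The factor {x} in \<open>?K\<close> turns the affine constraint of base point
  \<open>x\<close> into the kernel of a linear map.\<close>

lemma interior_fst_effective_domain:
  fixes B :: "'a::banach operator"
  assumes B: "maximal_monotone B"
  shows "interior (fst ` effective_domain (fitzpatrick B)) \<subseteq> Domain B"
proof
  fix x assume x: "x \<in> interior (fst ` effective_domain (fitzpatrick B))"
  let ?T = "\<lambda>w::(('a \<times> 'a dual) \<times> real) \<times> 'a. fst (fst (fst w)) - snd w"
  let ?\<rho> = "\<lambda>w::(('a \<times> 'a dual) \<times> real) \<times> 'a. snd (fst w) - blinfun_apply (snd (fst (fst w))) x"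
  let ?K = "fitzpatrick_epi B \<times> {x}"
  have "\<exists>u::'a dual. \<forall>w\<in>?K. 0 + blinfun_apply u (?T w) \<le> ?\<rho> w"
  proof (rule convex_duality)
    show "closed ?K" "convex ?K"
      by (auto intro!: closed_Times convex_Times closed_fitzpatrick_epi convex_fitzpatrick_epi)
    show "bounded_linear ?T" "bounded_linear ?\<rho>"
      by (intro bounded_linear_intros)+
    have "?T ` ?K = difference_set (fst ` effective_domain (fitzpatrick B)) {x}"
      unfolding difference_set_def effective_domain_fitzpatrick by force
    moreover have "0 \<in> ic (difference_set (fst ` effective_domain (fitzpatrick B)) {x})"
      by (rule zero_in_ic_interior[OF interior_difference_set(2)[OF _ x]]) simp
    ultimately show "0 \<in> ic (?T ` ?K)" by simp
    show "0 \<le> ?\<rho> w" if "w \<in> ?K" "?T w = 0" for w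
      using that maximal_monotone_epi_ge[OF B, of "fst (fst w)" "snd (fst w)"]
      by (auto simp: pairing_def)
  qed
  then obtain u :: "'a dual" where u: "\<And>w. w \<in> ?K \<Longrightarrow> blinfun_apply u (?T w) \<le> ?\<rho> w"
    unfolding add_0 by blast
  have "(x, u) \<in> B"
  proof (rule maximal_monotone_memI[OF B])
    fix b assume "b \<in> B"
    then have "(b, pairing b) \<in> fitzpatrick_epi B"
      using B by (simp add: maximal_monotone_def monotone_mem_epi)
    with u[of "((b, pairing b), x)"] show "0 \<le> pairing ((x, u) - b)"
      by (simp add: pairing_def blinfun.diff_left blinfun.diff_right)
  qed
  then show "x \<in> Domain B" by blast
qed

lemma convex_shrink_closure_interior:
  fixes S :: "'a::real_normed_vector set"
  assumes "convex S" "c \<in> interior S" "x \<in> closure S" "0 < t" "t \<le> 1"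
  shows "(1 - t) *\<^sub>R x + t *\<^sub>R c \<in> interior S"
proof -
  obtain d where d: "0 < d" "ball c d \<subseteq> S" using assms(2) by (auto simp: mem_interior)
  \<comment> \<open>The tolerance t d is the radius of the ball around (1 - t) s + t c obtained by
    shrinking the ball around \<open>c\<close> towards \<open>s\<close>; the target point then falls
    inside it.\<close>
  obtain s where s: "s \<in> S" "dist s x < t * d"
    using assms(3) d \<open>0 < t\<close> by (metis closure_approachable mult_pos_pos)
  have "ball ((1 - t) *\<^sub>R s + t *\<^sub>R c) (t * d) \<subseteq> S"
  proof
    fix y assume y: "y \<in> ball ((1 - t) *\<^sub>R s + t *\<^sub>R c) (t * d)"
    define c' where "c' = (1 / t) *\<^sub>R (y - (1 - t) *\<^sub>R s)"
    have y_eq: "y = (1 - t) *\<^sub>R s + t *\<^sub>R c'" using \<open>0 < t\<close> by (simp add: c'_def)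
    have "(1 - t) *\<^sub>R s + t *\<^sub>R c - y = t *\<^sub>R (c - c')" by (simp add: y_eq algebra_simps)
    then have "t * dist c c' < t * d" using y \<open>0 < t\<close> by (simp add: dist_norm)
    then have "c' \<in> S" using d \<open>0 < t\<close> by auto
    then show "y \<in> S" using assms s by (auto simp: y_eq intro: convexD)
  qed
  moreover have "(1 - t) *\<^sub>R x + t *\<^sub>R c \<in> ball ((1 - t) *\<^sub>R s + t *\<^sub>R c) (t * d)"
  proof -
    have "(1 - t) * norm (s - x) \<le> norm (s - x)"
      using assms by (intro mult_left_le_one_le) auto
    moreover have "(1 - t) *\<^sub>R s + t *\<^sub>R c - ((1 - t) *\<^sub>R x + t *\<^sub>R c) = (1 - t) *\<^sub>R (s - x)"
      by (simp add: algebra_simps)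
    ultimately show ?thesis using s assms by (simp add: dist_norm)
  qed
  ultimately show ?thesis by (metis interior_maximal open_ball subsetD)
qed

lemma segment_to_interior_tendsto: "(\<lambda>n. (1 - 1 / Suc n) *\<^sub>R x + (1 / Suc n) *\<^sub>R c) \<longlonglongrightarrow> x"
  for x c :: "'a::real_normed_vector"
proof -
  have "(\<lambda>n. 1 / real (Suc n)) \<longlonglongrightarrow> 0" using LIMSEQ_inverse_real_of_nat by (simp add: inverse_eq_divide)
  then have "(\<lambda>n. (1 - 1 / Suc n) *\<^sub>R x + (1 / Suc n) *\<^sub>R c) \<longlonglongrightarrow> (1 - 0) *\<^sub>R x + 0 *\<^sub>R c"
    by (intro tendsto_intros)
  then show ?thesis by simp
qed

text \<open>The projection \<open>Q\<close> of the effective domain is convex, contains the domain,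
  and has its interior inside the domain. Segments from the closure of \<open>Q\<close> to
  \<open>c\<close> run through that interior, so domain and \<open>Q\<close> have the same closure
  and convexity is inherited.\<close>

lemma maximal_monotone_Domain_interior:
  fixes B :: "'a::banach operator"
  assumes B: "maximal_monotone B" and c: "c \<in> interior (Domain B)"
  shows "convex (closure (Domain B))"
    and "\<And>x t. x \<in> closure (Domain B) \<Longrightarrow> 0 < t \<Longrightarrow> t \<le> 1 \<Longrightarrow>
      (1 - t) *\<^sub>R x + t *\<^sub>R c \<in> interior (Domain B)"
proof -
  define Q where "Q = fst ` effective_domain (fitzpatrick B)"
  have Q: "convex Q"
    unfolding Q_def effective_domain_fitzpatrick
    by (intro convex_linear_image bounded_linear.linear[OF bounded_linear_fst] convex_fitzpatrick_epi)
  have DQ: "Domain B \<subseteq> Q"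
    using B fst_effective_domain_superset by (auto simp: Q_def maximal_monotone_def)
  have QD: "interior Q \<subseteq> interior (Domain B)"
    using interior_fst_effective_domain[OF B] by (simp add: Q_def interior_maximal)
  have shrink: "(1 - t) *\<^sub>R x + t *\<^sub>R c \<in> interior (Domain B)" if "x \<in> closure Q" "0 < t" "t \<le> 1" for x t
    using convex_shrink_closure_interior[OF Q _ that] c QD interior_mono[OF DQ] by blast
  then show "(1 - t) *\<^sub>R x + t *\<^sub>R c \<in> interior (Domain B)"
    if "x \<in> closure (Domain B)" "0 < t" "t \<le> 1" for x t
    using that closure_mono[OF DQ] by blast
  have "x \<in> closure (Domain B)" if "x \<in> closure Q" for x
  proof (rule closed_sequentially[OF closed_closure _ segment_to_interior_tendsto[of x c]])
    fix n
    have "(1 - 1 / Suc n) *\<^sub>R x + (1 / Suc n) *\<^sub>R c \<in> interior (Domain B)"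
      by (rule shrink[OF that]) auto
    then show "(1 - 1 / Suc n) *\<^sub>R x + (1 / Suc n) *\<^sub>R c \<in> closure (Domain B)"
      using interior_subset closure_subset by blast
  qed
  then have "closure (Domain B) = closure Q" using closure_mono[OF DQ] by blast
  then show "convex (closure (Domain B))" using Q by simp
qed

section \<open>The criteria for the NI property and maximality of the sum\<close>

theorem theorem5p10:
  fixes A B :: "'a::banach operator"
  assumes "maximal_monotone A" and "maximal_monotone B"
  shows
    "(Domain A \<inter> Domain B \<noteq> {} \<and> closed (Domain A \<inter> Domain B) \<and> convex (Domain A \<inter> Domain B) \<and>
      normal_cone (Domain A \<inter> Domain B)
        = operator_sum (normal_cone (Domain A)) (normal_cone (Domain B))
      \<longrightarrow> NI_type (operator_sum A B))
   \<and> (closed (Domain A) \<and> convex (Domain A) \<and> closed (Domain B) \<and> convex (Domain B) \<and>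
      0 \<in> ic (difference_set (Domain A) (Domain B))
      \<longrightarrow> maximal_monotone (operator_sum A B))
   \<and> (closed (Domain A \<inter> Domain B) \<and> convex (closure (Domain A)) \<and>
      Domain A \<inter> interior (Domain B) \<noteq> {}
      \<longrightarrow> closure (Domain A) \<inter> closure (Domain B) = Domain A \<inter> Domain B \<and>
          maximal_monotone (operator_sum A B))
   \<and> (closed (Domain A) \<and> convex (Domain A) \<and> Domain A \<subseteq> Domain B
      \<longrightarrow> NI_type (operator_sum A B))
   \<and> (closed (Domain A) \<and> convex (Domain A) \<and> Domain A \<subseteq> Domain B \<and>
      0 \<in> ic (difference_set (Domain A) (fst ` effective_domain (fitzpatrick B)))
      \<longrightarrow> maximal_monotone (operator_sum A B))"
proof (intro conjI impI; (elim conjE)?)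
  note A = assms(1) and B = assms(2)
  have DA: "Domain A \<subseteq> fst ` effective_domain (fitzpatrick A)"
    and DB: "Domain B \<subseteq> fst ` effective_domain (fitzpatrick B)"
    using A B by (auto simp: maximal_monotone_def intro!: fst_effective_domain_superset)
  show "NI_type (operator_sum A B)"
    if "Domain A \<inter> Domain B \<noteq> {}" "closed (Domain A \<inter> Domain B)" "convex (Domain A \<inter> Domain B)"
      "normal_cone (Domain A \<inter> Domain B) = operator_sum (normal_cone (Domain A)) (normal_cone (Domain B))"
    using NI_type_operator_sum[OF A B that(1-3)] that(4) by blast
  show "maximal_monotone (operator_sum A B)"
    if CA: "closed (Domain A)" "convex (Domain A)" and CB: "closed (Domain B)" "convex (Domain B)"
      and ic: "0 \<in> ic (difference_set (Domain A) (Domain B))"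
  proof (rule maximal_monotone_operator_sum[OF A B])
    have "Domain A \<inter> Domain B \<noteq> {}"
      using zero_in_icD(2)[OF ic] by (auto simp: difference_set_def)
    then show "NI_type (operator_sum A B)"
      using CA CB by (intro NI_type_operator_sum[OF A B] normal_cone_Int ic) (auto intro: convex_Int)
    show "0 \<in> ic (difference_set (fst ` effective_domain (fitzpatrick A))
        (fst ` effective_domain (fitzpatrick B)))"
      using ic by (simp add: fst_effective_domain_fitzpatrick[OF A CA] fst_effective_domain_fitzpatrick[OF B CB])
  qed
  show NI: "NI_type (operator_sum A B)"
    if "closed (Domain A)" "convex (Domain A)" and sub: "Domain A \<subseteq> Domain B"
  proof (rule NI_type_operator_sum[OF A B])
    have Int: "Domain A \<inter> Domain B = Domain A" using sub by blast
    show "Domain A \<inter> Domain B \<noteq> {}" using maximal_monotone_nonempty[OF A] by (simp add: Int Domain_empty_iff)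
    show "closed (Domain A \<inter> Domain B)" "convex (Domain A \<inter> Domain B)" using that by (simp_all add: Int)
    show "normal_cone (Domain A \<inter> Domain B) \<subseteq> operator_sum (normal_cone (Domain A)) (normal_cone (Domain B))"
    proof clarify
      fix a n assume n: "(a, n) \<in> normal_cone (Domain A \<inter> Domain B)"
      then have "(a, n) \<in> normal_cone (Domain A)" "(a, 0) \<in> normal_cone (Domain B)"
        using sub unfolding Int by (auto simp: normal_cone_def)
      then show "(a, n) \<in> operator_sum (normal_cone (Domain A)) (normal_cone (Domain B))"
        unfolding operator_sum_def using add_0_right by force
    qed
  qed
  show "maximal_monotone (operator_sum A B)"
    if CA: "closed (Domain A)" "convex (Domain A)" and sub: "Domain A \<subseteq> Domain B"
      and ic: "0 \<in> ic (difference_set (Domain A) (fst ` effective_domain (fitzpatrick B)))"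
    using ic by (intro maximal_monotone_operator_sum[OF A B NI[OF CA sub]])
      (simp add: fst_effective_domain_fitzpatrick[OF A CA])
  assume cl: "closed (Domain A \<inter> Domain B)" and conv: "convex (closure (Domain A))"
    and ne: "Domain A \<inter> interior (Domain B) \<noteq> {}"
  obtain c where c: "c \<in> Domain A" "c \<in> interior (Domain B)" using ne by blast
  show Int: "closure (Domain A) \<inter> closure (Domain B) = Domain A \<inter> Domain B"
  proof
    show "closure (Domain A) \<inter> closure (Domain B) \<subseteq> Domain A \<inter> Domain B"
    proof
      fix x assume x: "x \<in> closure (Domain A) \<inter> closure (Domain B)"
      show "x \<in> Domain A \<inter> Domain B"
      proof (rule closed_sequentially[OF cl _ segment_to_interior_tendsto[of x c]])
        fix n
        let ?y = "(1 - 1 / Suc n) *\<^sub>R x + (1 / Suc n) *\<^sub>R c"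
        have "?y \<in> interior (Domain B)"
          using x by (intro maximal_monotone_Domain_interior(2)[OF B c(2)]) auto
        moreover have "?y \<in> closure (Domain A)"
          using x subsetD[OF closure_subset c(1)] by (intro convexD[OF conv]) auto
        \<comment> \<open>An open set meets every approximation of \<open>?y\<close> from
          \<open>Domain A\<close>, so \<open>?y\<close> is a limit of points in both domains. The
          intersection is closed, so it contains \<open>?y\<close>, and these points tend to
          \<open>x\<close>.\<close>
        ultimately have "?y \<in> closure (interior (Domain B) \<inter> Domain A)"
          using open_Int_closure_subset[OF open_interior] by blast
        also have "\<dots> \<subseteq> closure (Domain A \<inter> Domain B)"
          by (rule closure_mono) (use interior_subset in blast)
        finally show "?y \<in> Domain A \<inter> Domain B" using cl by simp
      qed
    qed
  qed (intro Int_mono closure_subset)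
  show "maximal_monotone (operator_sum A B)"
  proof (rule maximal_monotone_operator_sum[OF A B NI_type_operator_sum[OF A B _ cl]])
    show "Domain A \<inter> Domain B \<noteq> {}" using c interior_subset by blast
    have convB: "convex (closure (Domain B))" by (rule maximal_monotone_Domain_interior(1)[OF B c(2)])
    then show "convex (Domain A \<inter> Domain B)" using conv convex_Int Int by metis
    \<comment> \<open>The intersection rule for normal cones requires closed convex sets, so it is
      applied to the closures. By the identity just proved they have the same intersection as the
      domains, and a normal vector to a closure at a point of the set is normal to the set.\<close>
    have ic0: "0 \<in> ic (difference_set (closure (Domain A)) (closure (Domain B)))"
      by (intro zero_in_ic_interior interior_difference_set(1)[of c]
          subsetD[OF closure_subset c(1)] subsetD[OF interior_mono[OF closure_subset] c(2)])
    show "normal_cone (Domain A \<inter> Domain B) \<subseteq> operator_sum (normal_cone (Domain A)) (normal_cone (Domain B))"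
    proof clarify
      fix a n assume n: "(a, n) \<in> normal_cone (Domain A \<inter> Domain B)"
      then have a: "a \<in> Domain A" "a \<in> Domain B" by (auto simp: normal_cone_def)
      have restrict: "(a, u) \<in> normal_cone D"
        if "(a, u) \<in> normal_cone (closure D)" "a \<in> D" for u and D :: "'a set"
        using that subsetD[OF closure_subset[of D]] by (simp add: normal_cone_def)
      have "(a, n) \<in> operator_sum (normal_cone (closure (Domain A))) (normal_cone (closure (Domain B)))"
        using normal_cone_Int[OF closed_closure conv closed_closure convB ic0] n unfolding Int by blast
      then show "(a, n) \<in> operator_sum (normal_cone (Domain A)) (normal_cone (Domain B))"
        using restrict a unfolding operator_sum_def by blast
    qed
    show "0 \<in> ic (difference_set (fst ` effective_domain (fitzpatrick A))
        (fst ` effective_domain (fitzpatrick B)))"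
      by (intro zero_in_ic_interior interior_difference_set(1)[of c]
          subsetD[OF DA c(1)] subsetD[OF interior_mono[OF DB] c(2)])
  qed
qed

end
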